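(* Let $\mathbf{s}_1,\dots,\mathbf{s}_m\in\mathbb{R}^n$ be in general linear position, $m\le n+1$, and let $t_1,\dots,t_m\in\mathbb{R}$ be numbers that are not all equal. Assume that the system $$\lVert\mathbf{s}_i-\mathbf{x}\rVert^2=(t_i-b)^2\qquad(i=1,\dots,m)$$ has at least two solutions $(b,\mathbf{x})\in\mathbb{R}\times\mathbb{R}^n$, and that $m>2$ or $|t_1-t_2|\ne\lVert\mathbf{s}_1-\mathbf{s}_2\rVert$. Let $k:=n+1-m$ and let $U,\mathbf{u},\mathbf{v},\mathbf{w}_j,\mathbf{w}_i',\alpha,\beta,e,\mu,\rho,\lambda_1,\lambda_2,g,h,Q_{\mathrm{sol}},Q_{\mathrm{sat}}$ be as defined in the context. Then: (a) $$Q_{\mathrm{sol}}=\Bigl\{\mathbf{v}+y_0\mathbf{u}+\sum_{j=1}^k y_j\mathbf{w}_j\ \Big|\ y_0,\dots,y_k\in\mathbb{R},\ g(y_0,\dots,y_k)=0\Bigr\}$$ and $$Q_{\mathrm{sat}}=\Bigl\{\mathbf{v}+z_0\mathbf{u}+\sum_{i=1}^{m-2} z_i\mathbf{w}_i'\ \Big|\ z_0,\dots,z_{m-2}\in\mathbb{R},\ h(z_0,\dots,z_{m-2})=0\Bigr\}.$$ (b) The affine subspaces of $\mathbb{R}^n$ spanned by $Q_{\mathrm{sol}}$ and $Q_{\mathrm{sat}}$ are $$\mathcal{A}_{\mathrm{sol}}:=\langle Q_{\mathrm{sol}}\rangle_{\mathrm{aff}}=\mathbf{v}+\langle\mathbf{u},\mathbf{w}_1,\dots,\mathbf{w}_k\rangle_{\mathrm{lin}}=\mathbf{v}+\mathbb{R}\mathbf{u}+U^\perp$$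 and $$\mathcal{A}_{\mathrm{sat}}:=\langle Q_{\mathrm{sat}}\rangle_{\mathrm{aff}}=\mathbf{v}+\langle\mathbf{u},\mathbf{w}_1',\dots,\mathbf{w}_{m-2}'\rangle_{\mathrm{lin}}=\mathbf{v}+U=\langle\mathbf{s}_1,\dots,\mathbf{s}_m\rangle_{\mathrm{aff}}.$$ Their dimensions are $k+1$ and $m-1$. $\mathcal{A}_{\mathrm{sol}}$ and $\mathcal{A}_{\mathrm{sat}}$ are perpendicular, and their intersection is the line $\mathbf{v}+\mathbb{R}\mathbf{u}$. (c) Viewed as a subset of its affine span, each of $Q_{\mathrm{sol}}$ and $Q_{\mathrm{sat}}$ is a quadric with a focus. However, if $k=0$ then $Q_{\mathrm{sol}}$ consists of only two points, and if $m=2$ the same is true for $Q_{\mathrm{sat}}$. Both quadrics share the same axis of symmetry, which is $\mathbf{v}+\mathbb{R}\mathbf{u}=\mathcal{A}_{\mathrm{sol}}\cap\mathcal{A}_{\mathrm{sat}}$. (d) The foci (or the single focus in the case of a paraboloid) of $Q_{\mathrm{sat}}$ are the vertices (or the vertex) of $Q_{\mathrm{sol}}$ and vice versa. In particular, the foci of $Q_{\mathrm{sat}}$ are solutions of the system, i.e. each of them is the $\mathbf{x}$-component of a solution $(b,\mathbf{x})$. The eccentricities of $Q_{\mathrm{sol}}$ and $Q_{\mathrm{sat}}$ are reciprocal to each other. (e) $Q_{\mathrm{sol}}$ meets $\mathcal{A}_{\mathrm{sat}}$ perpendicularly. More precisely, the tangent space of $Q_{\mathrm{sol}}$ at every intersection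 point with $\mathcal{A}_{\mathrm{sat}}$ (these intersection points are the vertices of $Q_{\mathrm{sol}}$) is equal to the orthogonal complement $U^\perp$.
   Context: Throughout $n,m\ge1$ are integers, $\langle\cdot,\cdot\rangle$ and $\lVert\cdot\rVert$ are the Euclidean inner product and norm on $\mathbb{R}^n$, and $\langle\cdot\rangle_{\mathrm{lin}}$, $\langle\cdot\rangle_{\mathrm{aff}}$ denote linear and affine span. For $m\le n+1$, points $\mathbf{s}_1,\dots,\mathbf{s}_m$ are in general linear position if their affine span has dimension $m-1$. Solution sets. $\mathfrak{X}:=\{(b,\mathbf{x})\in\mathbb{R}\times\mathbb{R}^n\mid\lVert\mathbf{s}_i-\mathbf{x}\rVert^2=(t_i-b)^2\text{ for }i=1,\dots,m\}$ and $\mathcal{S}:=\{(t,\mathbf{s})\in\mathbb{R}\times\mathbb{R}^n\mid\lVert\mathbf{s}-\mathbf{x}\rVert^2=(t-b)^2\text{ for all }(b,\mathbf{x})\in\mathfrak{X}\}$. $Q_{\mathrm{sol}}:=\{\mathbf{x}\mid(b,\mathbf{x})\in\mathfrak{X}\text{ for some }b\in\mathbb{R}\}$ (quadric of solutions) and $Q_{\mathrm{sat}}:=\{\mathbf{s}\mid(t,\mathbf{s})\in\mathcal{S}\text{ for some }t\in\mathbb{R}\}$ (quadric of satellites). Auxiliary data. $U:=\langle\mathbf{s}_i-\mathbf{s}_1\mid2\le i\le m\rangle_{\mathrm{lin}}$ (of dimension $m-1$); $\mathbf{w}_1,\dots,\mathbf{w}_k$ is an orthonormal basis of $U^\perp$;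 $\gamma_j:=\langle\mathbf{s}_i,\mathbf{w}_j\rangle$, which does not depend on $i$. $(\mathbf{v},\beta)\in\mathbb{R}^n\times\mathbb{R}$ is the unique pair with $2\langle\mathbf{s}_i,\mathbf{v}\rangle-\beta=\lVert\mathbf{s}_i\rVert^2-t_i^2$ for all $i$ and $\langle\mathbf{v},\mathbf{w}_j\rangle=\gamma_j$ for all $j$. $(\mathbf{u},\alpha)\in\mathbb{R}^n\times\mathbb{R}$ is the unique pair with $\langle\mathbf{s}_i,\mathbf{u}\rangle-\alpha=t_i$ for all $i$ and $\langle\mathbf{u},\mathbf{w}_j\rangle=0$ for all $j$. One has $\mathbf{u}\in U$, and $\mathbf{u}\neq\mathbf{0}$ since the $t_i$ are not all equal. Put $e:=\lVert\mathbf{u}\rVert$; $\mathbf{w}_1',\dots,\mathbf{w}_{m-2}'$ are chosen such that together with $e^{-1}\mathbf{u}$ they form an orthonormal basis of $U$. If $e\ne1$: $\mu:=\frac{\langle\mathbf{u},\mathbf{v}\rangle-\alpha}{e^2-1}$, $\rho:=\frac{(\langle\mathbf{u},\mathbf{v}\rangle-\alpha)^2}{e^2-1}-\lVert\mathbf{v}\rVert^2+\beta$, $$g(y_0,\dots,y_k):=\sum_{j=1}^k y_j^2+\operatorname{sgn}(e^2-1)\Bigl(\sqrt{|e^2-1|}\,(y_0+\mu)\Bigr)^2-\rho,$$ $$h(z_0,\dots,z_{m-2}):=\sum_{i=1}^{m-2}z_i^2-\operatorname{sgn}(e^2-1)\Bigl(e\sqrt{|e^2-1|}\,(z_0+\mu)\Bigr)^2+\rho.$$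 If $e=1$ (under the hypotheses of the theorem $\langle\mathbf{u},\mathbf{v}\rangle\neq\alpha$ then holds): $\lambda_1:=\frac{\beta-\lVert\mathbf{v}\rVert^2}{2(\langle\mathbf{u},\mathbf{v}\rangle-\alpha)}$, $\lambda_2:=\lambda_1-\frac{\langle\mathbf{u},\mathbf{v}\rangle-\alpha}{2}$, $$g(y_0,\dots,y_k):=\sum_{j=1}^k y_j^2+2(\langle\mathbf{u},\mathbf{v}\rangle-\alpha)(y_0-\lambda_1),\qquad h(z_0,\dots,z_{m-2}):=\sum_{i=1}^{m-2}z_i^2-2(\langle\mathbf{u},\mathbf{v}\rangle-\alpha)(z_0-\lambda_2).$$ Perpendicularity. Two intersecting affine subspaces with direction spaces $W_1,W_2$ are perpendicular if the orthogonal complement of $W_1\cap W_2$ in $W_1$ is orthogonal to the orthogonal complement of $W_1\cap W_2$ in $W_2$ (as for two perpendicular planes in $\mathbb{R}^3$). Quadrics with a focus. In a Euclidean affine space with orthonormal coordinates $(\xi,\eta_1,\dots,\eta_d)$ these are: prolate spheroids $\xi^2/a^2+\sum\eta_j^2/b^2=1$ ($a>b>0$), with vertices at $\xi=\pm a$, $\eta=0$, eccentricity $\varepsilon=\sqrt{1-(b/a)^2}$ and foci at $\xi=\pm\varepsilon a$, $\eta=0$; hyperboloids of revolution of two sheets $\xi^2/a^2-\sum\eta_j^2/b^2=1$ ($a,b>0$), with vertices at $\xi=\pm a$, $\eta=0$, eccentricity $\varepsilon=\sqrt{1+(b/a)^2}$ and foci at $\xi=\pm\varepsilon a$, $\eta=0$;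 paraboloids of revolution $\sum\eta_j^2=2p\xi$ ($p\ne0$), with vertex the origin, focus at $\xi=p/2$, $\eta=0$, and eccentricity $1$. The axis of symmetry is the $\xi$-axis. (For $d=1$ these are ellipses, hyperbolas, parabolas, with the $\xi$-axis taken as the axis of symmetry.) Convention for $d=0$, where the set is just two points and $b$ is not determined by it: type, foci and eccentricity are assigned using the same formulas with the following semiaxes, which are read off from $g$ and $h$: for $Q_{\mathrm{sol}}$, $a=e\sqrt{\rho/(e^2-1)}$, $b=\sqrt{|\rho|}$, type spheroid if $e>1$ and hyperboloid if $e<1$; for $Q_{\mathrm{sat}}$, $a=\sqrt{\rho/(e^2-1)}$, $b=\sqrt{|\rho|}$, type hyperboloid if $e>1$ and spheroid if $e<1$; in both cases the center is $\mathbf{v}-\mu\mathbf{u}$ and the axis is $\mathbf{v}+\mathbb{R}\mathbf{u}$. *)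

theory Defs
  imports "HOL-Analysis.Analysis"
begin

definition solution_set :: "nat \<Rightarrow> (nat \<Rightarrow> 'a::euclidean_space) \<Rightarrow> (nat \<Rightarrow> real) \<Rightarrow> (real \<times> 'a) set" where
  "solution_set m s t = {(b, x). \<forall>i\<in>{1..m}. (norm (s i - x))\<^sup>2 = (t i - b)\<^sup>2}"

definition satellite_set :: "(real \<times> 'a::euclidean_space) set \<Rightarrow> (real \<times> 'a) set" where
  "satellite_set X = {(t, s). \<forall>(b, x)\<in>X. (norm (s - x))\<^sup>2 = (t - b)\<^sup>2}"

definition Q_sol :: "nat \<Rightarrow> (nat \<Rightarrow> 'a::euclidean_space) \<Rightarrow> (nat \<Rightarrow> real) \<Rightarrow> 'a set" where
  "Q_sol m s t = {x. \<exists>b. (b, x) \<in> solution_set m s t}"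

definition Q_sat :: "nat \<Rightarrow> (nat \<Rightarrow> 'a::euclidean_space) \<Rightarrow> (nat \<Rightarrow> real) \<Rightarrow> 'a set" where
  "Q_sat m s t = {x. \<exists>\<tau>. (\<tau>, x) \<in> satellite_set (solution_set m s t)}"

definition orthonormal_basis :: "'i set \<Rightarrow> ('i \<Rightarrow> 'a::euclidean_space) \<Rightarrow> 'a set \<Rightarrow> bool" where
  "orthonormal_basis I q W \<longleftrightarrow>
     (\<forall>i\<in>I. \<forall>j\<in>I. q i \<bullet> q j = (if i = j then 1 else 0)) \<and> span (q ` I) = W"

definition direction_space :: "'a::euclidean_space set \<Rightarrow> 'a set" where
  "direction_space A = {x - y | x y. x \<in> A \<and> y \<in> A}"

definition orth_complement_in :: "'a::euclidean_space set \<Rightarrow> 'a set \<Rightarrow> 'a set" where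
  "orth_complement_in W V = {x \<in> W. \<forall>y\<in>V. orthogonal x y}"

definition perpendicular :: "'a::euclidean_space set \<Rightarrow> 'a set \<Rightarrow> bool" where
  "perpendicular A B \<longleftrightarrow> affine A \<and> affine B \<and> A \<inter> B \<noteq> {} \<and>
     (\<forall>x \<in> orth_complement_in (direction_space A) (direction_space A \<inter> direction_space B).
      \<forall>y \<in> orth_complement_in (direction_space B) (direction_space A \<inter> direction_space B).
        orthogonal x y)"

text \<open>Tangent vectors are the velocities of \<open>C\<^sup>1\<close> curves running in \<open>Q\<close>; for a smooth quadric this is
  its tangent space, as a linear subspace of the ambient space.\<close>

definition tangent_space :: "'a::euclidean_space set \<Rightarrow> 'a \<Rightarrow> 'a set" where
  "tangent_space Q p = {z. \<exists>c \<delta>. \<delta> > 0 \<and> c 0 = p \<and> (\<forall>r\<in>{-\<delta><..<\<delta>}. c r \<in> Q) \<and>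
     c C1_differentiable_on {-\<delta><..<\<delta>} \<and> (c has_vector_derivative z) (at 0)}"

text \<open>A quadric with a focus, presented by its standard equation. The first two arguments are the
  origin and the orthonormal axes \<open>q 0, \<dots>, q d\<close> of the coordinates \<open>(\<xi>, \<eta>\<^sub>1, \<dots>, \<eta>\<^sub>d)\<close>, with \<open>q 0\<close> the
  direction of the \<open>\<xi>\<close>-axis; values \<open>q j\<close> with \<open>j > d\<close> are irrelevant. The remaining arguments are
  \<open>a\<close> and \<open>b\<close>, or \<open>p\<close>. The same set has several presentations (change of sign or choice of the axes);
  for \<open>d \<ge> 1\<close> vertices, foci, eccentricity and axis do not depend on the presentation, for \<open>d = 0\<close>
  they depend on \<open>b\<close>.\<close>

datatype 'a focal_quadric =
    Spheroid 'a "nat \<Rightarrow> 'a" real real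
  | Hyperboloid 'a "nat \<Rightarrow> 'a" real real
  | Paraboloid 'a "nat \<Rightarrow> 'a" real

fun origin :: "'a focal_quadric \<Rightarrow> 'a" where
  "origin (Spheroid c q a b) = c"
| "origin (Hyperboloid c q a b) = c"
| "origin (Paraboloid c q p) = c"

fun axes :: "'a focal_quadric \<Rightarrow> nat \<Rightarrow> 'a" where
  "axes (Spheroid c q a b) = q"
| "axes (Hyperboloid c q a b) = q"
| "axes (Paraboloid c q p) = q"

fun admissible :: "'a focal_quadric \<Rightarrow> bool" where
  "admissible (Spheroid c q a b) \<longleftrightarrow> a > b \<and> b > 0"
| "admissible (Hyperboloid c q a b) \<longleftrightarrow> a > 0 \<and> b > 0"
| "admissible (Paraboloid c q p) \<longleftrightarrow> p \<noteq> 0"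

fun equation :: "nat \<Rightarrow> 'a focal_quadric \<Rightarrow> real \<Rightarrow> (nat \<Rightarrow> real) \<Rightarrow> bool" where
  "equation d (Spheroid c q a b) \<xi> \<eta> \<longleftrightarrow> \<xi>\<^sup>2 / a\<^sup>2 + (\<Sum>j=1..d. (\<eta> j)\<^sup>2 / b\<^sup>2) = 1"
| "equation d (Hyperboloid c q a b) \<xi> \<eta> \<longleftrightarrow> \<xi>\<^sup>2 / a\<^sup>2 - (\<Sum>j=1..d. (\<eta> j)\<^sup>2 / b\<^sup>2) = 1"
| "equation d (Paraboloid c q p) \<xi> \<eta> \<longleftrightarrow> (\<Sum>j=1..d. (\<eta> j)\<^sup>2) = 2 * p * \<xi>"

definition points :: "nat \<Rightarrow> 'a::euclidean_space focal_quadric \<Rightarrow> 'a set" where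
  "points d F = {origin F + \<xi> *\<^sub>R axes F 0 + (\<Sum>j=1..d. \<eta> j *\<^sub>R axes F j) | \<xi> \<eta>. equation d F \<xi> \<eta>}"

fun eccentricity :: "'a focal_quadric \<Rightarrow> real" where
  "eccentricity (Spheroid c q a b) = sqrt (1 - (b / a)\<^sup>2)"
| "eccentricity (Hyperboloid c q a b) = sqrt (1 + (b / a)\<^sup>2)"
| "eccentricity (Paraboloid c q p) = 1"

fun vertices :: "'a::euclidean_space focal_quadric \<Rightarrow> 'a set" where
  "vertices (Spheroid c q a b) = {c + a *\<^sub>R q 0, c - a *\<^sub>R q 0}"
| "vertices (Hyperboloid c q a b) = {c + a *\<^sub>R q 0, c - a *\<^sub>R q 0}"
| "vertices (Paraboloid c q p) = {c}"

fun foci :: "'a::euclidean_space focal_quadric \<Rightarrow> 'a set" where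
  "foci (Spheroid c q a b) =
     (let \<epsilon> = eccentricity (Spheroid c q a b) in {c + (\<epsilon> * a) *\<^sub>R q 0, c - (\<epsilon> * a) *\<^sub>R q 0})"
| "foci (Hyperboloid c q a b) =
     (let \<epsilon> = eccentricity (Hyperboloid c q a b) in {c + (\<epsilon> * a) *\<^sub>R q 0, c - (\<epsilon> * a) *\<^sub>R q 0})"
| "foci (Paraboloid c q p) = {c + (p / 2) *\<^sub>R q 0}"

definition symmetry_axis :: "'a::euclidean_space focal_quadric \<Rightarrow> 'a set" where
  "symmetry_axis F = {origin F + \<xi> *\<^sub>R axes F 0 | \<xi>. True}"

text \<open>\<open>F\<close> presents \<open>Q\<close> as a quadric with a focus in the affine span of \<open>Q\<close>, of dimension \<open>d + 1\<close>.\<close>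

definition presents :: "nat \<Rightarrow> 'a::euclidean_space set \<Rightarrow> 'a focal_quadric \<Rightarrow> bool" where
  "presents d Q F \<longleftrightarrow> admissible F \<and> origin F \<in> affine hull Q \<and>
     orthonormal_basis {0..d} (axes F) (direction_space (affine hull Q)) \<and> Q = points d F"

end

theory Submission
  imports Defs
begin

text \<open>
  Translating by \<open>v\<close> turns the data into \<open>t\<^sub>i = \<kappa> + \<langle>s\<^sub>i - v, u\<rangle>\<close> and \<open>\<parallel>s\<^sub>i - v\<parallel>\<^sup>2 = t\<^sub>i\<^sup>2 + C\<close> with
  \<open>\<kappa> = \<langle>u, v\<rangle> - \<alpha>\<close> and \<open>C = \<parallel>v\<parallel>\<^sup>2 - \<beta>\<close>. In these terms the solutions are \<open>x = v + b u + y\<close> with \<open>y \<in> U\<^sup>\<bottom>\<close> and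
  one quadratic equation in \<open>(b, \<parallel>y\<parallel>)\<close>. The satellite equation restricted to the solutions is affine, so
  it persists on their affine hull, and comparing coefficients yields the satellites. Both sets are of the
  form \<open>\<parallel>x - c\<parallel>\<^sup>2 - \<epsilon>\<^sup>2 \<langle>x - c, q\<rangle>\<^sup>2 - 2p \<langle>x - c, q\<rangle> = \<sigma>\<close>, with the same axis and with \<open>\<epsilon> = 1/e\<close> and \<open>\<epsilon> = e\<close>,
  respectively. In dimension at least two such a set determines \<open>c\<close>, \<open>\<epsilon>\<close>, \<open>p\<close> and \<open>q\<close> up to a common sign of
  \<open>p\<close> and \<open>q\<close>, as one sees by comparing the equations on planes through the axis; hence vertices, foci and
  eccentricity do not depend on the presentation.
\<close>

text \<open>The claims on vertices, foci and eccentricity concern every presentation of a quadric.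
  Exhibiting one is therefore only half of the work: uniqueness of the normal form has to carry its
  invariants over to all others. Two-point quadrics have no such uniqueness, since their second
  semiaxis is invisible, and this is why centre and semiaxes are prescribed for them. The other
  obstacle is degeneration. For \<open>e \<noteq> 1\<close>, \<rho> must have the sign of
  \<open>e\<^sup>2 - 1\<close>; for \<open>e = 1\<close>, \<kappa> must not vanish and both affine
  spans need dimension at least two. Each of these facts uses a different hypothesis on the data.
  The satellites are found from a hyperplane containing all solutions, so the affine hull of the
  solutions has to be known first. The exchange of foci and vertices comes from completing squares:
  both polynomials have the same centre and opposite constants.\<close>

section \<open>Orthonormal bases and translates of subspaces\<close>

lemma in_span_image_iff_sum:
  fixes f :: "'i \<Rightarrow> 'a::real_vector"
  assumes "finite I"
  shows "x \<in> span (f ` I) \<longleftrightarrow> (\<exists>y. x = (\<Sum>i\<in>I. y i *\<^sub>R f i))"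
proof
  assume "x \<in> span (f ` I)"
  then show "\<exists>y. x = (\<Sum>i\<in>I. y i *\<^sub>R f i)"
  proof (induction rule: span_induct_alt)
    case base
    have "0 = (\<Sum>i\<in>I. 0 *\<^sub>R f i)" by simp
    then show ?case by (intro exI[of _ "\<lambda>_. 0"]) simp
  next
    case (step c z x)
    then obtain y i where y: "x = (\<Sum>i\<in>I. y i *\<^sub>R f i)" and i: "i \<in> I" "z = f i" by auto
    have "c *\<^sub>R z + x = (\<Sum>j\<in>I. (y j + (if j = i then c else 0)) *\<^sub>R f j)"
      using i assms y by (simp add: scaleR_left_distrib sum.distrib if_distrib[of "\<lambda>c. c *\<^sub>R _"] cong: if_cong)
    then show ?case by (rule exI[of "\<lambda>y. c *\<^sub>R z + x = (\<Sum>i\<in>I. y i *\<^sub>R f i)"])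
  qed
next
  assume "\<exists>y. x = (\<Sum>i\<in>I. y i *\<^sub>R f i)"
  then show "x \<in> span (f ` I)"
    by (auto intro!: span_sum span_scale intro: span_base)
qed

lemma orthonormal_basisD:
  assumes "orthonormal_basis I q W"
  shows "\<And>i j. i \<in> I \<Longrightarrow> j \<in> I \<Longrightarrow> q i \<bullet> q j = (if i = j then 1 else 0)" and "span (q ` I) = W"
  using assms by (auto simp: orthonormal_basis_def)

lemma orthonormal_basis_subspace: "orthonormal_basis I q W \<Longrightarrow> subspace W"
  by (auto simp: orthonormal_basis_def)

lemma orthonormal_basis_in: "orthonormal_basis I q W \<Longrightarrow> i \<in> I \<Longrightarrow> q i \<in> W"
  by (auto simp: orthonormal_basis_def intro: span_base)

lemma orthonormal_basis_norm: "orthonormal_basis I q W \<Longrightarrow> i \<in> I \<Longrightarrow> norm (q i) = 1"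
  by (simp add: orthonormal_basis_def norm_eq_1)

lemma orthonormal_basis_in_iff:
  assumes "orthonormal_basis I q W" "finite I"
  shows "x \<in> W \<longleftrightarrow> (\<exists>y. x = (\<Sum>i\<in>I. y i *\<^sub>R q i))"
  using in_span_image_iff_sum[OF assms(2)] orthonormal_basisD(2)[OF assms(1)] by metis

lemma orthonormal_basis_inner_sum:
  assumes "orthonormal_basis I q W" "finite I" "J \<subseteq> I" "i \<in> I"
  shows "(\<Sum>j\<in>J. y j *\<^sub>R q j) \<bullet> q i = (if i \<in> J then y i else 0)"
proof -
  have "finite J" using assms finite_subset by blast
  have "(\<Sum>j\<in>J. y j *\<^sub>R q j) \<bullet> q i = (\<Sum>j\<in>J. if j = i then y j else 0)"
    using assms by (auto simp: inner_sum_left orthonormal_basisD(1)[OF assms(1)] intro!: sum.cong)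
  then show ?thesis using \<open>finite J\<close> by simp
qed

lemma orthonormal_basis_inner_self:
  assumes "orthonormal_basis I q W" "finite I" "J \<subseteq> I"
  shows "(\<Sum>j\<in>J. y j *\<^sub>R q j) \<bullet> (\<Sum>j\<in>J. y j *\<^sub>R q j) = (\<Sum>j\<in>J. (y j)\<^sup>2)"
  using assms(3)
  by (subst inner_sum_right)
    (auto simp: orthonormal_basis_inner_sum[OF assms] power2_eq_square subset_iff intro!: sum.cong)

lemma dim_orthonormal_basis:
  assumes "orthonormal_basis I q W"
  shows "dim W = card I"
proof -
  note D = orthonormal_basisD[OF assms]
  have "inj_on q I"
  proof (rule inj_onI)
    fix i j assume ij: "i \<in> I" "j \<in> I" "q i = q j"
    then show "i = j" using D(1)[of i j] D(1)[of i i] by (auto split: if_splits)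
  qed
  moreover have "independent (q ` I)"
  proof (rule pairwise_orthogonal_independent)
    show "pairwise orthogonal (q ` I)"
      using D(1) by (force simp: pairwise_def orthogonal_def)
    show "0 \<notin> q ` I" using D(1) by (metis imageE inner_zero_left zero_neq_one)
  qed
  ultimately show ?thesis
    using D(2) by (metis card_image dim_span_eq_card_independent)
qed

lemma direction_space_translation:
  assumes "subspace W"
  shows "direction_space ((+) c ` W) = W"
proof (intro set_eqI iffI)
  fix x assume "x \<in> direction_space ((+) c ` W)"
  then show "x \<in> W" using assms by (auto simp: direction_space_def intro: subspace_diff)
next
  fix x assume "x \<in> W"
  then have "x = (c + x) - (c + 0)" "c + x \<in> (+) c ` W" "c + 0 \<in> (+) c ` W"
    using subspace_0[OF assms] by auto
  then show "x \<in> direction_space ((+) c ` W)" unfolding direction_space_def by blast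
qed

lemma affine_translation_subspace: "subspace W \<Longrightarrow> affine ((+) c ` W)"
  by (metis affine_translation subspace_imp_affine)

lemma mem_translation_iff: "x \<in> (+) c ` W \<longleftrightarrow> x - c \<in> W" for x c :: "'a::ab_group_add"
  by (metis (no_types, lifting) add.commute diff_add_cancel image_iff add_diff_cancel_left')

lemma translation_subspace_eq:
  assumes "subspace W" "c - c' \<in> W"
  shows "(+) c ` W = (+) c' ` W"
proof -
  have "x - c \<in> W \<longleftrightarrow> x - c' \<in> W" for x
    using subspace_add[OF assms(1), of "x - c" "c - c'"] subspace_diff[OF assms(1), of "x - c'" "c - c'"]
      assms(2) by auto
  then show ?thesis by (auto simp: mem_translation_iff set_eq_iff)
qed

section \<open>Quadrics with a focus\<close>

text \<open>Since \<open>\<Sum>j. \<eta>\<^sub>j\<^sup>2 = \<parallel>x - c\<parallel>\<^sup>2 - \<xi>\<^sup>2\<close>, multiplying the three standard equations by \<open>\<plusminus>b\<^sup>2\<close> brings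
  them into one form, in which only the constants \<open>\<epsilon>\<close> (the eccentricity), \<open>p\<close> and \<open>\<sigma>\<close> differ.\<close>

definition focal_set :: "'a::euclidean_space set \<Rightarrow> 'a \<Rightarrow> 'a \<Rightarrow> real \<Rightarrow> real \<Rightarrow> real \<Rightarrow> 'a set" where
  "focal_set W c q \<epsilon> p \<sigma> =
     {x. x - c \<in> W \<and> (x - c) \<bullet> (x - c) - \<epsilon>\<^sup>2 * ((x - c) \<bullet> q)\<^sup>2 - 2 * p * ((x - c) \<bullet> q) = \<sigma>}"

text \<open>The cases are spheroid, hyperboloid and paraboloid. On the axis the equation reads
  \<open>(1 - \<epsilon>\<^sup>2) * \<xi>\<^sup>2 - 2 * p * \<xi> = \<sigma>\<close>, so the signs
  say that there are two vertices, or one if \<epsilon> = 1. Spheres, cones and empty sets are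
  excluded.\<close>

definition focal_constants :: "real \<Rightarrow> real \<Rightarrow> real \<Rightarrow> bool" where
  "focal_constants \<epsilon> p \<sigma> \<longleftrightarrow> 0 < \<epsilon> \<and> (\<epsilon> < 1 \<and> p = 0 \<and> 0 < \<sigma> \<or> 1 < \<epsilon> \<and> p = 0 \<and> \<sigma> < 0 \<or> \<epsilon> = 1 \<and> p \<noteq> 0 \<and> \<sigma> = 0)"

fun linear_constant :: "'a focal_quadric \<Rightarrow> real" where
  "linear_constant (Spheroid c q a b) = 0"
| "linear_constant (Hyperboloid c q a b) = 0"
| "linear_constant (Paraboloid c q p) = p"

fun level_constant :: "'a focal_quadric \<Rightarrow> real" where
  "level_constant (Spheroid c q a b) = b\<^sup>2"
| "level_constant (Hyperboloid c q a b) = - b\<^sup>2"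
| "level_constant (Paraboloid c q p) = 0"

abbreviation focal_form :: "'a::euclidean_space set \<Rightarrow> 'a focal_quadric \<Rightarrow> 'a set" where
  "focal_form W F \<equiv>
     focal_set W (origin F) (axes F 0) (eccentricity F) (linear_constant F) (level_constant F)"

lemma spheroid_eccentricity:
  assumes "b < a" "0 < b"
  shows "(sqrt (1 - (b / a)\<^sup>2))\<^sup>2 = 1 - (b / a)\<^sup>2" "0 < sqrt (1 - (b / a)\<^sup>2)" "sqrt (1 - (b / a)\<^sup>2) < 1"
proof -
  have "(b / a)\<^sup>2 < 1" using assms by (simp add: power_less_one_iff abs_square_less_1)
  moreover have "0 < (b / a)\<^sup>2" using assms by simp
  ultimately show "(sqrt (1 - (b / a)\<^sup>2))\<^sup>2 = 1 - (b / a)\<^sup>2" "0 < sqrt (1 - (b / a)\<^sup>2)"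
    "sqrt (1 - (b / a)\<^sup>2) < 1" by (auto simp: real_sqrt_lt_1_iff)
qed

lemma hyperboloid_eccentricity:
  assumes "0 < a" "0 < b"
  shows "(sqrt (1 + (b / a)\<^sup>2))\<^sup>2 = 1 + (b / a)\<^sup>2" "1 < sqrt (1 + (b / a)\<^sup>2)"
proof -
  have "0 < (b / a)\<^sup>2" using assms by simp
  then show "(sqrt (1 + (b / a)\<^sup>2))\<^sup>2 = 1 + (b / a)\<^sup>2" "1 < sqrt (1 + (b / a)\<^sup>2)"
    by (auto simp: real_sqrt_gt_1_iff)
qed

lemma focal_constants_admissible:
  assumes "admissible F"
  shows "focal_constants (eccentricity F) (linear_constant F) (level_constant F)"
proof (cases F)
  case (Spheroid c q a b)
  then show ?thesis using assms spheroid_eccentricity[of b a] by (simp add: focal_constants_def)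
next
  case (Hyperboloid c q a b)
  then show ?thesis using assms hyperboloid_eccentricity[of a b]
    by (simp add: focal_constants_def add_pos_pos)
next
  case (Paraboloid c q p)
  then show ?thesis using assms by (simp add: focal_constants_def)
qed

lemma equation_iff_focal:
  assumes "admissible F"
  shows "equation d F \<xi> \<eta> \<longleftrightarrow>
    \<xi>\<^sup>2 + (\<Sum>j=1..d. (\<eta> j)\<^sup>2) - (eccentricity F)\<^sup>2 * \<xi>\<^sup>2 - 2 * linear_constant F * \<xi> = level_constant F"
proof (cases F)
  case (Spheroid c q a b)
  then have "a > b" "b > 0" using assms by auto
  then show ?thesis unfolding Spheroid
    by (simp add: spheroid_eccentricity sum_divide_distrib[symmetric] field_simps power_divide) argo
next
  case (Hyperboloid c q a b)
  then have "a > 0" "b > 0" using assms by auto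
  then show ?thesis unfolding Hyperboloid
    by (simp add: hyperboloid_eccentricity sum_divide_distrib[symmetric] field_simps power_divide)
next
  case (Paraboloid c q p)
  then show ?thesis by auto
qed

lemma points_eq_focal_form:
  assumes F: "admissible F" and W: "orthonormal_basis {0..d} (axes F) W"
  shows "points d F = focal_form W F"
proof -
  let ?q = "axes F" and ?c = "origin F"
  have split: "(\<Sum>j\<in>{0..d}. f j) = f 0 + (\<Sum>j=1..d. f j)" for f :: "nat \<Rightarrow> 'b::comm_monoid_add"
    by (simp add: sum.atLeast_Suc_atMost)
  have inner: "z \<bullet> z = (y 0)\<^sup>2 + (\<Sum>j=1..d. (y j)\<^sup>2)" "z \<bullet> ?q 0 = y 0"
    if "z = y 0 *\<^sub>R ?q 0 + (\<Sum>j=1..d. y j *\<^sub>R ?q j)" for z y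
    using orthonormal_basis_inner_self[OF W, of "{0..d}" y]
      orthonormal_basis_inner_sum[OF W, of "{0..d}" 0 y] unfolding that split by auto
  have eq: "z \<bullet> z - (eccentricity F)\<^sup>2 * (z \<bullet> ?q 0)\<^sup>2 - 2 * linear_constant F * (z \<bullet> ?q 0) = level_constant F
      \<longleftrightarrow> equation d F (y 0) y"
    if "z = y 0 *\<^sub>R ?q 0 + (\<Sum>j=1..d. y j *\<^sub>R ?q j)" for z y
    by (simp add: inner[OF that] equation_iff_focal[OF F])
  \<comment> \<open>The sums start at 1, so \<open>\<eta> 0\<close> is never read; this slot can
    hold \<xi>, and all coordinates become one function on \<open>{0..d}\<close>.\<close>
  have cong: "equation d F \<xi> \<eta> \<longleftrightarrow> equation d F \<xi> (\<eta>(0 := \<xi>))" for \<xi> \<eta>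
    by (simp add: equation_iff_focal[OF F])
  show ?thesis
  proof (intro set_eqI iffI)
    fix x assume "x \<in> points d F"
    then obtain \<xi> \<eta> where x: "x = ?c + \<xi> *\<^sub>R ?q 0 + (\<Sum>j=1..d. \<eta> j *\<^sub>R ?q j)" and E: "equation d F \<xi> \<eta>"
      unfolding points_def by blast
    define y where "y = \<eta>(0 := \<xi>)"
    have z: "x - ?c = y 0 *\<^sub>R ?q 0 + (\<Sum>j=1..d. y j *\<^sub>R ?q j)"
      by (simp add: x y_def)
    have "x - ?c \<in> W"
      using orthonormal_basis_in_iff[OF W] z split[of "\<lambda>j. y j *\<^sub>R ?q j"]
      by (metis finite_atLeastAtMost)
    moreover have "equation d F (y 0) y" using E cong by (simp add: y_def)
    ultimately show "x \<in> focal_form W F" using eq[OF z] by (simp add: focal_set_def)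
  next
    fix x assume x: "x \<in> focal_form W F"
    then obtain y where y: "x - ?c = (\<Sum>j\<in>{0..d}. y j *\<^sub>R ?q j)"
      using orthonormal_basis_in_iff[OF W] by (auto simp: focal_set_def)
    then have z: "x - ?c = y 0 *\<^sub>R ?q 0 + (\<Sum>j=1..d. y j *\<^sub>R ?q j)"
      by (simp add: split)
    then have "equation d F (y 0) y" using x eq[OF z] by (simp add: focal_set_def)
    moreover have "x = ?c + y 0 *\<^sub>R ?q 0 + (\<Sum>j=1..d. y j *\<^sub>R ?q j)"
      using z by (simp add: algebra_simps)
    ultimately show "x \<in> points d F" unfolding points_def by blast
  qed
qed

text \<open>Describes the vertices by the normal form alone, as the points of the set on its axis;
  they are thus determined by the set and its axis.\<close>

lemma vertices_eq_axis_points: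
  assumes F: "admissible F"
  shows "vertices F = {origin F + \<xi> *\<^sub>R axes F 0 | \<xi>.
    (1 - (eccentricity F)\<^sup>2) * \<xi>\<^sup>2 - 2 * linear_constant F * \<xi> = level_constant F}"
proof (cases F)
  case (Spheroid c q a b)
  then have ab: "a > b" "b > 0" using assms by auto
  then have "(1 - (eccentricity F)\<^sup>2) * \<xi>\<^sup>2 - 2 * linear_constant F * \<xi> = level_constant F \<longleftrightarrow> \<xi>\<^sup>2 = a\<^sup>2" for \<xi>
    unfolding Spheroid by (simp add: spheroid_eccentricity power_divide field_simps)
  then show ?thesis unfolding Spheroid by (auto simp: power2_eq_iff)
    (metis diff_conv_add_uminus scaleR_minus_left)
next
  case (Hyperboloid c q a b)
  then have ab: "a > 0" "b > 0" using assms by auto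
  then have "(1 - (eccentricity F)\<^sup>2) * \<xi>\<^sup>2 - 2 * linear_constant F * \<xi> = level_constant F \<longleftrightarrow> \<xi>\<^sup>2 = a\<^sup>2" for \<xi>
    unfolding Hyperboloid by (simp add: hyperboloid_eccentricity power_divide field_simps)
  then show ?thesis unfolding Hyperboloid by (auto simp: power2_eq_iff)
    (metis diff_conv_add_uminus scaleR_minus_left)
next
  case (Paraboloid c q p)
  then show ?thesis using assms by auto
qed

text \<open>For central quadrics the foci are the vertices scaled by the eccentricity about the
  centre. For paraboloids only the product of the linear constant and the axis vector enters, which
  survives a common change of sign.\<close>

lemma foci_eq:
  assumes "admissible F"
  shows "foci F = (if eccentricity F = 1 then {origin F + (linear_constant F / 2) *\<^sub>R axes F 0}
    else (\<lambda>x. origin F + eccentricity F *\<^sub>R (x - origin F)) ` vertices F)"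
proof (cases F)
  case (Spheroid c q a b)
  then have "eccentricity F \<noteq> 1" using assms spheroid_eccentricity[of b a] by auto
  then show ?thesis unfolding Spheroid by (simp add: Let_def)
next
  case (Hyperboloid c q a b)
  then have "eccentricity F \<noteq> 1" using assms hyperboloid_eccentricity[of a b] by auto
  then show ?thesis unfolding Hyperboloid by (simp add: Let_def)
qed simp

section \<open>Plane sections, affine hull and uniqueness of the normal form\<close>

lemma focal_set_axis_iff:
  assumes "subspace W" "q \<in> W" "norm q = 1"
  shows "c + \<xi> *\<^sub>R q \<in> focal_set W c q \<epsilon> p \<sigma> \<longleftrightarrow> (1 - \<epsilon>\<^sup>2) * \<xi>\<^sup>2 - 2 * p * \<xi> = \<sigma>"
  using assms by (auto simp: focal_set_def subspace_scale norm_eq_1 algebra_simps power2_eq_square)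

lemma focal_set_slice_iff:
  assumes "subspace W" "q \<in> W" "norm q = 1" "n \<in> W" "norm n = 1" "n \<bullet> q = 0"
  shows "c + \<xi> *\<^sub>R q + \<eta> *\<^sub>R n \<in> focal_set W c q \<epsilon> p \<sigma> \<longleftrightarrow> \<eta>\<^sup>2 = \<sigma> + 2 * p * \<xi> - (1 - \<epsilon>\<^sup>2) * \<xi>\<^sup>2"
proof -
  define z where "z = \<xi> *\<^sub>R q + \<eta> *\<^sub>R n"
  have "z \<in> W" using assms by (simp add: z_def subspace_add subspace_scale)
  moreover have "z \<bullet> z = \<xi>\<^sup>2 + \<eta>\<^sup>2" "z \<bullet> q = \<xi>"
    using assms by (auto simp: z_def norm_eq_1 inner_add_left inner_add_right power2_eq_square inner_commute)
  moreover have "c + \<xi> *\<^sub>R q + \<eta> *\<^sub>R n - c = z" by (simp add: z_def)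
  ultimately show ?thesis by (simp add: focal_set_def algebra_simps)
qed

text \<open>Three abscissas with two symmetric points each: enough to annihilate a polynomial of
  degree two in \<xi>.\<close>

lemma focal_constants_three_slices:
  assumes "focal_constants \<epsilon> p \<sigma>"
  obtains x y z where "x \<noteq> y" "y \<noteq> z" "x \<noteq> z"
    "\<And>\<xi>. \<xi> \<in> {x, y, z} \<Longrightarrow> 0 < \<sigma> + 2 * p * \<xi> - (1 - \<epsilon>\<^sup>2) * \<xi>\<^sup>2"
proof -
  have "0 < \<epsilon>" using assms by (simp add: focal_constants_def)
  consider "\<epsilon> < 1" "p = 0" "0 < \<sigma>" | "1 < \<epsilon>" "p = 0" "\<sigma> < 0" | "\<epsilon> = 1" "p \<noteq> 0" "\<sigma> = 0"
    using assms by (auto simp: focal_constants_def)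
  then show thesis
  proof cases
    case 1
    have "0 < \<epsilon>\<^sup>2 * \<sigma>" using 1 \<open>0 < \<epsilon>\<close> by simp
    then have "0 < \<sigma> - (1 - \<epsilon>\<^sup>2) * \<sigma>" by (simp add: algebra_simps)
    with 1 show thesis by (intro that[of 0 "sqrt \<sigma>" "- sqrt \<sigma>"]) auto
  next
    case 2
    then have e: "0 < \<epsilon>\<^sup>2 - 1" by (simp add: power2_eq_square mult_strict_mono less_1_mult)
    \<comment> \<open>With this L the value at \<open>r * L\<close> is
      \<open>\<sigma> + (1 - \<sigma>) * r\<^sup>2\<close>, which is at least 1 for
      \<open>r \<ge> 1\<close>.\<close>
    define L where "L = sqrt ((1 - \<sigma>) / (\<epsilon>\<^sup>2 - 1))"
    have "(1 - \<sigma>) / (\<epsilon>\<^sup>2 - 1) > 0" using e 2 by (intro divide_pos_pos) auto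
    then have "L > 0" and "L\<^sup>2 = (1 - \<sigma>) / (\<epsilon>\<^sup>2 - 1)" by (auto simp: L_def)
    then have L2: "L\<^sup>2 * (\<epsilon>\<^sup>2 - 1) = 1 - \<sigma>" using e by (metis less_irrefl nonzero_eq_divide_eq)
    have "0 < \<sigma> - (1 - \<epsilon>\<^sup>2) * (r * L)\<^sup>2" if "r \<ge> 1" for r
    proof -
      have "(1 - \<sigma>) * 1 \<le> (1 - \<sigma>) * r\<^sup>2"
        using that 2 by (intro mult_left_mono) auto
      also have "\<dots> = - (1 - \<epsilon>\<^sup>2) * (r * L)\<^sup>2" by (simp add: L2[symmetric] power_mult_distrib algebra_simps)
      finally show ?thesis by (simp add: left_diff_distrib)
    qed
    from this[of 1] this[of 2] this[of 3] 2 \<open>L > 0\<close> show thesis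
      by (intro that[of L "2 * L" "3 * L"]) auto
  next
    case 3
    then have "0 < p * p" by (auto simp: zero_less_mult_iff linorder_neq_iff)
    with 3 show thesis by (intro that[of p "2 * p" "3 * p"]) auto
  qed
qed

lemma quadratic_eq_0_of_three_roots:
  fixes A B C :: real
  assumes "x \<noteq> y" "y \<noteq> z" "x \<noteq> z" and "\<And>\<xi>. \<xi> \<in> {x, y, z} \<Longrightarrow> A * \<xi>\<^sup>2 + B * \<xi> + C = 0"
  shows "A = 0 \<and> B = 0 \<and> C = 0"
proof -
  have 1: "A * x\<^sup>2 + B * x + C = 0" "A * y\<^sup>2 + B * y + C = 0" "A * z\<^sup>2 + B * z + C = 0"
    using assms(4) by auto
  have "(x - y) * (A * (x + y) + B) = 0" "(x - z) * (A * (x + z) + B) = 0"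
    using 1 by (auto simp: algebra_simps power2_eq_square)
  then have 2: "A * (x + y) + B = 0" "A * (x + z) + B = 0" using assms by auto
  then have "A * (y - z) = 0" by algebra
  then have "A = 0" using assms by simp
  then show ?thesis using 1 2 by auto
qed

text \<open>Where the section has the two points with ordinates \<eta> and -\<eta>, sums and
  differences separate the parts even and odd in \<eta>. The odd part leaves a linear polynomial
  with two zeros. Eliminating \<open>\<eta>\<^sup>2\<close> from the even part leaves a quadratic
  polynomial with three zeros.\<close>

lemma conic_vanishing_imp_proportional:
  assumes fc: "focal_constants \<epsilon> p \<sigma>"
    and van: "\<And>\<xi> \<eta>. \<eta>\<^sup>2 = \<sigma> + 2 * p * \<xi> - (1 - \<epsilon>\<^sup>2) * \<xi>\<^sup>2 \<Longrightarrow>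
      C * \<eta>\<^sup>2 + B * (\<xi> * \<eta>) + A * \<xi>\<^sup>2 + E * \<eta> + D * \<xi> + G = 0"
  shows "B = 0 \<and> E = 0 \<and> A = C * (1 - \<epsilon>\<^sup>2) \<and> D = - 2 * p * C \<and> G = - \<sigma> * C"
proof -
  obtain x y z where dist: "x \<noteq> y" "y \<noteq> z" "x \<noteq> z"
    and pos: "\<And>\<xi>. \<xi> \<in> {x, y, z} \<Longrightarrow> 0 < \<sigma> + 2 * p * \<xi> - (1 - \<epsilon>\<^sup>2) * \<xi>\<^sup>2"
    using focal_constants_three_slices[OF fc] by metis
  have root: "B * \<xi> + E = 0 \<and> (A - C * (1 - \<epsilon>\<^sup>2)) * \<xi>\<^sup>2 + (D + 2 * p * C) * \<xi> + (G + \<sigma> * C) = 0"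
    if "\<xi> \<in> {x, y, z}" for \<xi>
  proof -
    define \<phi> where "\<phi> = \<sigma> + 2 * p * \<xi> - (1 - \<epsilon>\<^sup>2) * \<xi>\<^sup>2"
    have "\<phi> > 0" using pos[OF that] by (simp add: \<phi>_def)
    then have "C * \<phi> + B * (\<xi> * sqrt \<phi>) + A * \<xi>\<^sup>2 + E * sqrt \<phi> + D * \<xi> + G = 0"
      "C * \<phi> - B * (\<xi> * sqrt \<phi>) + A * \<xi>\<^sup>2 - E * sqrt \<phi> + D * \<xi> + G = 0"
      using van[of "sqrt \<phi>" \<xi>] van[of "- sqrt \<phi>" \<xi>] by (auto simp: \<phi>_def)
    then have "(B * \<xi> + E) * sqrt \<phi> = 0" and \<phi>: "C * \<phi> + A * \<xi>\<^sup>2 + D * \<xi> + G = 0"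
      by (auto simp: algebra_simps)
    then have "B * \<xi> + E = 0" using \<open>\<phi> > 0\<close> by simp
    with \<phi> show ?thesis by (simp add: \<phi>_def algebra_simps)
  qed
  have E: "B * x + E = 0" "B * y + E = 0" using root by auto
  then have "B * (x - y) = 0" by algebra
  then have "B = 0" "E = 0" using dist E by auto
  moreover have "A - C * (1 - \<epsilon>\<^sup>2) = 0 \<and> D + 2 * p * C = 0 \<and> G + \<sigma> * C = 0"
    using root by (intro quadratic_eq_0_of_three_roots[OF dist]) blast
  ultimately show ?thesis by auto
qed

lemma exists_unit_orthogonal:
  fixes W :: "'a::euclidean_space set"
  assumes "subspace W" "2 \<le> dim W" "q \<in> W"
  obtains n where "n \<in> W" "norm n = 1" "n \<bullet> q = 0"
proof -
  have "dim {q} \<le> 1" using dim_le_card[of "{q}" "{q}"] by (simp add: span_superset)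
  then have "span {q} \<noteq> span W" using assms(2) by (metis dim_span not_less_eq_eq numeral_2_eq_2 One_nat_def order_trans)
  moreover have "span {q} \<subseteq> span W" using assms by (intro span_mono) auto
  ultimately obtain x where x: "x \<noteq> 0" "x \<in> span W" "\<And>y. y \<in> span {q} \<Longrightarrow> orthogonal x y"
    using orthogonal_to_subspace_exists_gen[of "{q}" W] by auto
  have "x \<in> W" using x assms by (simp add: span_eq_iff[THEN iffD2])
  moreover have "x \<bullet> q = 0" using x(3)[of q] by (simp add: orthogonal_def span_base)
  ultimately show thesis using x assms by (intro that[of "x /\<^sub>R norm x"]) (auto simp: subspace_scale)
qed

lemma line_in_affine:
  fixes y :: "'a::real_vector" and a b :: real
  assumes "affine H" "x + a *\<^sub>R y \<in> H" "x + b *\<^sub>R y \<in> H" "a \<noteq> b"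
  shows "x + r *\<^sub>R y \<in> H"
proof -
  define k where "k = (r - a) / (b - a)"
  have "(1 - k) *\<^sub>R (x + a *\<^sub>R y) + k *\<^sub>R (x + b *\<^sub>R y) \<in> H"
    using assms by (intro mem_affine) auto
  also have "(1 - k) *\<^sub>R (x + a *\<^sub>R y) + k *\<^sub>R (x + b *\<^sub>R y) = x + (a + k * (b - a)) *\<^sub>R y"
    by (simp add: algebra_simps)
  also have "a + k * (b - a) = r" using assms(4) by (simp add: k_def)
  finally show ?thesis .
qed

text \<open>Chords orthogonal to the axis, at two abscissas, put whole lines into the hull. The axis
  is the line through the two vertices. A paraboloid has only one vertex, so its axis is taken
  through the feet of two chords; this needs a second dimension, and in dimension one the set is a
  single point.\<close>

lemma affine_hull_focal_set:
  fixes W :: "'a::euclidean_space set"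
  assumes W: "subspace W" and q: "q \<in> W" "norm q = 1" and fc: "focal_constants \<epsilon> p \<sigma>"
    and dim: "\<epsilon> \<noteq> 1 \<or> 2 \<le> dim W"
  shows "affine hull (focal_set W c q \<epsilon> p \<sigma>) = (+) c ` W"
proof
  let ?Q = "focal_set W c q \<epsilon> p \<sigma>" and ?H = "affine hull (focal_set W c q \<epsilon> p \<sigma>)"
  show "?H \<subseteq> (+) c ` W"
    by (rule hull_minimal) (auto simp: focal_set_def mem_translation_iff affine_translation_subspace W)
  obtain x y where xy: "x \<noteq> y" and pos: "0 < \<sigma> + 2 * p * x - (1 - \<epsilon>\<^sup>2) * x\<^sup>2" "0 < \<sigma> + 2 * p * y - (1 - \<epsilon>\<^sup>2) * y\<^sup>2"
    using focal_constants_three_slices[OF fc] by (metis insert_iff)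
  have off_axis: "c + \<xi> *\<^sub>R q + \<eta> *\<^sub>R n \<in> ?H"
    if n: "n \<in> W" "norm n = 1" "n \<bullet> q = 0" and "\<xi> \<in> {x, y}" for \<xi> \<eta> n
  proof -
    define \<phi> where "\<phi> = sqrt (\<sigma> + 2 * p * \<xi> - (1 - \<epsilon>\<^sup>2) * \<xi>\<^sup>2)"
    have "\<phi> > 0" "\<phi>\<^sup>2 = \<sigma> + 2 * p * \<xi> - (1 - \<epsilon>\<^sup>2) * \<xi>\<^sup>2"
      using pos that by (auto simp: \<phi>_def)
    then have "c + \<xi> *\<^sub>R q + \<phi> *\<^sub>R n \<in> ?Q" "c + \<xi> *\<^sub>R q + (- \<phi>) *\<^sub>R n \<in> ?Q" "\<phi> \<noteq> - \<phi>"
      unfolding focal_set_slice_iff[OF W q n] by auto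
    then show ?thesis by - (rule line_in_affine[of _ _ \<phi> _ "- \<phi>"], auto intro: hull_inc)
  qed
  have axis: "c + \<xi> *\<^sub>R q \<in> ?H" for \<xi>
  proof (cases "\<epsilon> = 1")
    case True
    then obtain n where n: "n \<in> W" "norm n = 1" "n \<bullet> q = 0"
      using exists_unit_orthogonal[OF W _ q(1)] dim by blast
    show ?thesis
      using off_axis[OF n, of x 0] off_axis[OF n, of y 0] xy by - (rule line_in_affine[of _ _ x _ y], auto intro: hull_inc)
  next
    case False
    then have p: "p = 0" and \<sigma>: "\<sigma> / (1 - \<epsilon>\<^sup>2) > 0" "1 - \<epsilon>\<^sup>2 \<noteq> 0"
      using fc by (auto simp: focal_constants_def zero_less_divide_iff abs_square_less_1 power2_eq_1_iff
        one_less_power)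
    \<comment> \<open>The abscissas of the vertices are \<open>L\<close> and
      \<open>- L\<close>.\<close>
    define L where "L = sqrt (\<sigma> / (1 - \<epsilon>\<^sup>2))"
    have "L > 0" "L\<^sup>2 * (1 - \<epsilon>\<^sup>2) = \<sigma>" using \<sigma> by (auto simp: L_def)
    then have "c + L *\<^sub>R q \<in> ?Q" "c + (- L) *\<^sub>R q \<in> ?Q" "L \<noteq> - L"
      unfolding focal_set_axis_iff[OF W q] by (auto simp: p mult.commute)
    then show ?thesis by - (rule line_in_affine[of _ _ L _ "- L"], auto intro: hull_inc)
  qed
  show "(+) c ` W \<subseteq> ?H"
  proof
    fix z assume "z \<in> (+) c ` W"
    then have z: "z - c \<in> W" by (simp add: mem_translation_iff)
    define d where "d = z - c - ((z - c) \<bullet> q) *\<^sub>R q"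
    have d: "d \<in> W" "d \<bullet> q = 0"
      using z W q by (auto simp: d_def subspace_diff subspace_scale inner_diff_left norm_eq_1)
    have "c + x *\<^sub>R q + d \<in> ?H"
    proof (cases "d = 0")
      case False
      then show ?thesis
        using off_axis[of "d /\<^sub>R norm d" x "norm d"] d W by (auto simp: subspace_scale)
    qed (simp add: axis)
    \<comment> \<open>The fourth vertex of a parallelogram: the orthogonal component is shifted
      along the axis from abscissa x to that of z.\<close>
    then have "1 *\<^sub>R (c + x *\<^sub>R q + d) + (-1) *\<^sub>R (c + x *\<^sub>R q) + 1 *\<^sub>R (c + ((z - c) \<bullet> q) *\<^sub>R q) \<in> ?H"
      using axis by (intro mem_affine_3) auto
    then show "z \<in> ?H" by (simp add: d_def)
  qed
qed

text \<open>On each plane through the second axis, the first equation is a polynomial vanishing on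
  the second conic, hence a multiple of that conic's equation. The vanishing mixed coefficient makes
  the axes parallel once they are known not to be orthogonal; the other coefficients then identify
  the constants.\<close>

lemma focal_set_unique:
  fixes W :: "'a::euclidean_space set"
  assumes W: "subspace W" "2 \<le> dim W"
    and q: "q \<in> W" "norm q = 1" and q': "q' \<in> W" "norm q' = 1"
    and fc: "focal_constants \<epsilon> p \<sigma>" and fc': "focal_constants \<epsilon>' p' \<sigma>'"
    and c: "c' - c \<in> W"
    and eq: "focal_set W c q \<epsilon> p \<sigma> = focal_set W c' q' \<epsilon>' p' \<sigma>'"
  shows "c = c' \<and> \<epsilon> = \<epsilon>' \<and> (q = q' \<and> p = p' \<or> q = - q' \<and> p = - p')"
proof -
  define \<delta> where "\<delta> = c' - c"
  define a where "a = q' \<bullet> q"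
  define D' where "D' = \<delta> \<bullet> q'"
  define Dq where "Dq = \<delta> \<bullet> q"
  have pos: "0 < \<epsilon>" "0 < \<epsilon>'" using fc fc' by (auto simp: focal_constants_def)
  \<comment> \<open>In order: the coefficients of \<xi>\<eta>, \<eta>, \<open>\<xi>\<^sup>2\<close>,
    \<xi> and 1, up to constant factors. The factor of proportionality is the coefficient of
    \<open>\<eta>\<^sup>2\<close>, namely
    \<open>1 - \<epsilon>\<^sup>2 * (n \<bullet> q)\<^sup>2\<close>.\<close>
  have key: "a * (n \<bullet> q) = 0 \<and> \<delta> \<bullet> n - \<epsilon>\<^sup>2 * Dq * (n \<bullet> q) - p * (n \<bullet> q) = 0 \<and>
      1 - \<epsilon>\<^sup>2 * a\<^sup>2 = (1 - \<epsilon>\<^sup>2 * (n \<bullet> q)\<^sup>2) * (1 - \<epsilon>'\<^sup>2) \<and>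
      D' - \<epsilon>\<^sup>2 * Dq * a - p * a = - p' * (1 - \<epsilon>\<^sup>2 * (n \<bullet> q)\<^sup>2) \<and>
      \<delta> \<bullet> \<delta> - \<epsilon>\<^sup>2 * Dq\<^sup>2 - 2 * p * Dq - \<sigma> = - \<sigma>' * (1 - \<epsilon>\<^sup>2 * (n \<bullet> q)\<^sup>2)"
    if n: "n \<in> W" "norm n = 1" "n \<bullet> q' = 0" for n
  proof -
    define b where "b = n \<bullet> q"
    define Dn where "Dn = \<delta> \<bullet> n"
    have "(1 - \<epsilon>\<^sup>2 * b\<^sup>2) * \<eta>\<^sup>2 + (- 2 * \<epsilon>\<^sup>2 * a * b) * (\<xi> * \<eta>) + (1 - \<epsilon>\<^sup>2 * a\<^sup>2) * \<xi>\<^sup>2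
        + (2 * Dn - 2 * \<epsilon>\<^sup>2 * Dq * b - 2 * p * b) * \<eta> + (2 * D' - 2 * \<epsilon>\<^sup>2 * Dq * a - 2 * p * a) * \<xi>
        + (\<delta> \<bullet> \<delta> - \<epsilon>\<^sup>2 * Dq\<^sup>2 - 2 * p * Dq - \<sigma>) = 0"
      if "\<eta>\<^sup>2 = \<sigma>' + 2 * p' * \<xi> - (1 - \<epsilon>'\<^sup>2) * \<xi>\<^sup>2" for \<xi> \<eta>
    proof -
      have "c' + \<xi> *\<^sub>R q' + \<eta> *\<^sub>R n \<in> focal_set W c q \<epsilon> p \<sigma>"
        unfolding eq focal_set_slice_iff[OF W(1) q' n] by (rule that)
      moreover have "c' + \<xi> *\<^sub>R q' + \<eta> *\<^sub>R n - c = \<delta> + \<xi> *\<^sub>R q' + \<eta> *\<^sub>R n" by (simp add: \<delta>_def)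
      moreover have "(\<delta> + \<xi> *\<^sub>R q' + \<eta> *\<^sub>R n) \<bullet> q = Dq + \<xi> * a + \<eta> * b"
        by (simp add: Dq_def a_def b_def inner_add_left)
      moreover have "(\<delta> + \<xi> *\<^sub>R q' + \<eta> *\<^sub>R n) \<bullet> (\<delta> + \<xi> *\<^sub>R q' + \<eta> *\<^sub>R n)
          = \<delta> \<bullet> \<delta> + \<xi>\<^sup>2 + \<eta>\<^sup>2 + 2 * \<xi> * D' + 2 * \<eta> * Dn"
        using n q' by (simp add: D'_def Dn_def inner_add_left inner_add_right inner_commute norm_eq_1
          power2_eq_square algebra_simps)
      ultimately have "\<delta> \<bullet> \<delta> + \<xi>\<^sup>2 + \<eta>\<^sup>2 + 2 * \<xi> * D' + 2 * \<eta> * Dn - \<epsilon>\<^sup>2 * (Dq + \<xi> * a + \<eta> * b)\<^sup>2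
          - 2 * p * (Dq + \<xi> * a + \<eta> * b) = \<sigma>"
        by (simp add: focal_set_def)
      then show ?thesis by (simp add: power2_eq_square algebra_simps)
    qed
    from conic_vanishing_imp_proportional[OF fc' this] pos
    show ?thesis by (auto simp: b_def Dn_def)
  qed
  obtain n where n: "n \<in> W" "norm n = 1" "n \<bullet> q' = 0"
    using exists_unit_orthogonal[OF W q'(1)] by blast
  have "a \<noteq> 0"
  proof
    \<comment> \<open>Otherwise the major axes are orthogonal, both sets are hyperboloids, and they are conjugate to
      each other, which contradicts the signs of the constants.\<close>
    assume a: "a = 0"
    then have "q \<bullet> q' = 0" by (simp add: a_def inner_commute)
    note K = key[OF q this]
    have qq: "q \<bullet> q = 1" using q by (simp add: norm_eq_1)
    \<comment> \<open>The choice \<open>n = q\<close> is possible since q is orthogonal to q' here.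
      Two positive numbers below 1 cannot have product 1, so both factors are negative.\<close>
    have prod: "(1 - \<epsilon>\<^sup>2) * (1 - \<epsilon>'\<^sup>2) = 1" using K a qq by simp
    have "\<epsilon> > 1"
    proof (rule ccontr)
      assume "\<not> 1 < \<epsilon>"
      then have 1: "0 \<le> 1 - \<epsilon>\<^sup>2" "1 - \<epsilon>\<^sup>2 < 1" using pos by (auto simp: abs_square_le_1)
      have "0 < (1 - \<epsilon>\<^sup>2) * (1 - \<epsilon>'\<^sup>2)" using prod by simp
      then have 2: "0 < 1 - \<epsilon>\<^sup>2" "0 < 1 - \<epsilon>'\<^sup>2" using 1 by (auto simp: zero_less_mult_iff)
      have "(1 - \<epsilon>\<^sup>2) * (1 - \<epsilon>'\<^sup>2) < 1 * 1"
        using 1 2 pos by (intro mult_strict_mono) auto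
      then show False using prod by simp
    qed
    then have e: "1 - \<epsilon>\<^sup>2 < 0" "p = 0" "\<sigma> < 0" using fc by (auto simp: focal_constants_def one_less_power)
    have "1 - \<epsilon>'\<^sup>2 < 0" using prod e by (smt (verit) mult_nonpos_nonneg)
    then have "1 < \<epsilon>'" using power_le_one[of \<epsilon>' 2] pos by force
    then have e': "\<sigma>' < 0" using fc' by (auto simp: focal_constants_def)
    have "Dq * (1 - \<epsilon>\<^sup>2) = 0" using K qq e by (simp add: Dq_def algebra_simps)
    then have "Dq = 0" using e by simp
    then have "\<delta> \<bullet> \<delta> - \<sigma> = - \<sigma>' * (1 - \<epsilon>\<^sup>2)" using K qq e by simp
    moreover have "\<delta> \<bullet> \<delta> - \<sigma> > 0" using e inner_ge_zero[of \<delta>] by linarith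
    moreover have "- \<sigma>' * (1 - \<epsilon>\<^sup>2) < 0" using e e' by (simp add: mult_neg_neg)
    ultimately show False by simp
  qed
  then have n_q: "n \<bullet> q = 0" "\<delta> \<bullet> n = 0" if "n \<in> W" "norm n = 1" "n \<bullet> q' = 0" for n
    using key[OF that] by auto
  have parallel: "y = (y \<bullet> q') *\<^sub>R q'" if "y \<in> W" "\<And>n. n \<in> W \<Longrightarrow> norm n = 1 \<Longrightarrow> n \<bullet> q' = 0 \<Longrightarrow> n \<bullet> y = 0" for y
  proof (rule ccontr)
    define z where "z = y - (y \<bullet> q') *\<^sub>R q'"
    assume "y \<noteq> (y \<bullet> q') *\<^sub>R q'"
    then have z: "z \<noteq> 0" "z \<in> W" "z \<bullet> q' = 0"
      using that(1) W q' by (auto simp: z_def subspace_diff subspace_scale inner_diff_left norm_eq_1)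
    then have "(z /\<^sub>R norm z) \<bullet> y = 0" using W by (intro that(2)) (auto simp: subspace_scale)
    then have "z \<bullet> y = 0" using z by simp
    then have "z \<bullet> z = 0" using z(3) by (simp add: z_def inner_diff_right)
    then show False using z by simp
  qed
  have q_eq: "q = a *\<^sub>R q'" unfolding a_def inner_commute[of q' q] by (rule parallel[OF q(1) n_q(1)])
  have "\<bar>a\<bar> = 1" using arg_cong[OF q_eq, of norm] q q' by simp
  then have a: "a = 1 \<or> a = -1" and a2: "a\<^sup>2 = 1" by (auto simp: abs_if power2_eq_1_iff split: if_splits)
  have \<delta>: "\<delta> = D' *\<^sub>R q'"
    unfolding D'_def using c by (intro parallel) (auto simp: \<delta>_def[symmetric] inner_commute[of _ \<delta>] n_q(2))
  have Dq: "Dq = a * D'" by (simp add: Dq_def q_eq D'_def)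
  note K = key[OF n, unfolded n_q(1)[OF n]]
  have "\<epsilon>\<^sup>2 = \<epsilon>'\<^sup>2" using K a2 by simp
  then have \<epsilon>: "\<epsilon> = \<epsilon>'" using pos by simp
  have K2: "D' * (1 - \<epsilon>\<^sup>2) = p * a - p'"
    using K a2 by (simp add: Dq algebra_simps power2_eq_square)
  have K3: "D'\<^sup>2 - \<epsilon>\<^sup>2 * D'\<^sup>2 - 2 * p * a * D' - \<sigma> = - \<sigma>'"
  proof -
    have "\<delta> \<bullet> \<delta> = D'\<^sup>2" using q' by (simp add: \<delta> norm_eq_1 power2_eq_square)
    then show ?thesis using K a2 by (simp add: Dq power_mult_distrib mult.assoc \<epsilon>)
  qed
  \<comment> \<open>For \<epsilon> = 1 the linear coefficient gives \<open>p' = p * a\<close> and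
    the constant one then gives \<open>D' = 0\<close>; otherwise p and p' vanish and the linear
    coefficient suffices.\<close>
  have "D' = 0 \<and> p' = p * a"
  proof (cases "\<epsilon> = 1")
    case True
    then have "\<sigma> = 0" "\<sigma>' = 0" "p \<noteq> 0" using fc fc' \<epsilon> by (auto simp: focal_constants_def)
    then show ?thesis using K2 K3 True \<open>a \<noteq> 0\<close> by auto
  next
    case False
    then have "p = 0" "p' = 0" "1 - \<epsilon>\<^sup>2 \<noteq> 0"
      using fc fc' \<epsilon> pos by (auto simp: focal_constants_def power2_eq_1_iff)
    then show ?thesis using K2 by simp
  qed
  then show ?thesis using a q_eq \<epsilon> \<delta> by (auto simp: \<delta>_def)
qed

section \<open>Presentations and the invariants they determine\<close>

lemma presents_focal_form:
  assumes "presents d Q F"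
  defines "W \<equiv> direction_space (affine hull Q)"
  shows "subspace W" "dim W = d + 1" "axes F 0 \<in> W" "norm (axes F 0) = 1" "Q = focal_form W F"
    "focal_constants (eccentricity F) (linear_constant F) (level_constant F)"
proof -
  have F: "admissible F" "Q = points d F" and W: "orthonormal_basis {0..d} (axes F) W"
    using assms by (auto simp: presents_def)
  show "subspace W" by (rule orthonormal_basis_subspace[OF W])
  show "dim W = d + 1" using dim_orthonormal_basis[OF W] by simp
  show "axes F 0 \<in> W" "norm (axes F 0) = 1"
    using orthonormal_basis_in[OF W, of 0] orthonormal_basis_norm[OF W, of 0] by auto
  show "Q = focal_form W F" using F(2) points_eq_focal_form[OF F(1) W] by simp
  show "focal_constants (eccentricity F) (linear_constant F) (level_constant F)"
    by (rule focal_constants_admissible[OF F(1)])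
qed

lemma presents_focal_form_intro:
  assumes F: "admissible F" and W: "orthonormal_basis {0..d} (axes F) W"
    and Q: "Q = focal_form W F" and d: "eccentricity F \<noteq> 1 \<or> 1 \<le> d"
  shows "presents d Q F" "affine hull Q = (+) (origin F) ` W"
proof -
  have sub: "subspace W" by (rule orthonormal_basis_subspace[OF W])
  have "dim W = d + 1" using dim_orthonormal_basis[OF W] by simp
  then show hull: "affine hull Q = (+) (origin F) ` W"
    unfolding Q using d orthonormal_basis_in[OF W, of 0] orthonormal_basis_norm[OF W, of 0]
    by (intro affine_hull_focal_set sub focal_constants_admissible F) auto
  show "presents d Q F"
    unfolding presents_def hull direction_space_translation[OF sub] mem_translation_iff
    using assms points_eq_focal_form[OF F W] subspace_0[OF sub] by simp
qed

text \<open>Serves both to compare the vertices of two presentations and to find the intersection of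
  one quadric with the span of the other.\<close>

lemma presents_axis_Int:
  assumes "presents d Q F"
  shows "Q \<inter> symmetry_axis F = vertices F"
proof -
  note P = presents_focal_form[OF assms]
  have F: "admissible F" using assms by (simp add: presents_def)
  show ?thesis
    unfolding vertices_eq_axis_points[OF F] symmetry_axis_def
    by (subst P(5)) (auto simp: focal_set_axis_iff[OF P(1,3,4)])
qed

lemma affine_eq_translation_direction_space:
  assumes "affine A" "a \<in> A"
  shows "A = (+) a ` direction_space A"
proof (intro set_eqI iffI)
  fix x assume "x \<in> A"
  then show "x \<in> (+) a ` direction_space A"
    using assms(2) unfolding mem_translation_iff direction_space_def by blast
next
  fix x assume "x \<in> (+) a ` direction_space A"
  then obtain y z where "x = a + (y - z)" "y \<in> A" "z \<in> A"
    by (auto simp: direction_space_def)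
  then show "x \<in> A" using mem_affine_3[OF assms(1,2), of y z 1 1 "-1"] by (simp add: add_diff_eq)
qed

lemma presents_0_axis:
  assumes "presents 0 Q F"
  shows "symmetry_axis F = affine hull Q"
proof -
  have F: "origin F \<in> affine hull Q" "direction_space (affine hull Q) = span {axes F 0}"
    using assms by (auto simp: presents_def orthonormal_basis_def)
  have "affine hull Q = (+) (origin F) ` span {axes F 0}"
    using affine_eq_translation_direction_space[OF affine_affine_hull F(1)] F(2) by simp
  then show ?thesis by (auto simp: symmetry_axis_def span_singleton)
qed

lemma presents_invariants_pos:
  assumes F: "presents d Q F" and F': "presents d Q F'" and d: "1 \<le> d"
  shows "eccentricity F = eccentricity F'" "symmetry_axis F = symmetry_axis F'"
    "vertices F = vertices F'" "foci F = foci F'"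
proof -
  note P = presents_focal_form[OF F] and P' = presents_focal_form[OF F']
  have "origin F' - origin F \<in> direction_space (affine hull Q)"
    using F F' unfolding presents_def direction_space_def by blast
  then have *: "origin F = origin F' \<and> eccentricity F = eccentricity F' \<and>
    (axes F 0 = axes F' 0 \<and> linear_constant F = linear_constant F' \<or>
     axes F 0 = - axes F' 0 \<and> linear_constant F = - linear_constant F')"
    using d P P' by (intro focal_set_unique[OF P(1) _ P(3,4) P'(3,4) P(6) P'(6)]) auto
  show ecc: "eccentricity F = eccentricity F'" using * by simp
  have minus: "{c + \<xi> *\<^sub>R (- q) | \<xi>. True} = {c + \<xi> *\<^sub>R q | \<xi>. True}" for c q :: 'a
  proof (intro set_eqI iffI; clarify)
    show "\<exists>\<xi>'. c + \<xi> *\<^sub>R (- q) = c + \<xi>' *\<^sub>R q \<and> True" for \<xi> by (rule exI[of _ "- \<xi>"]) simp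
    show "\<exists>\<xi>'. c + \<xi> *\<^sub>R q = c + \<xi>' *\<^sub>R (- q) \<and> True" for \<xi> by (rule exI[of _ "- \<xi>"]) simp
  qed
  show axis: "symmetry_axis F = symmetry_axis F'"
    using * unfolding symmetry_axis_def by (elim conjE disjE) (simp_all only: minus)
  then show vert: "vertices F = vertices F'"
    using presents_axis_Int[OF F] presents_axis_Int[OF F'] by simp
  have "admissible F" "admissible F'" using F F' by (auto simp: presents_def)
  then show "foci F = foci F'"
    using * vert by (auto simp: foci_eq)
qed

text \<open>For \<open>d = 0\<close> the axis is the affine span, so axis and vertices still come
  from the set. The foci depend on centre and eccentricity, which the hypothesis \<open>d\<close>
  supplies.\<close>

lemma presents_invariants:
  assumes F: "presents d Q F" and F': "presents d Q F'"
    and d: "d = 0 \<Longrightarrow> origin F = origin F' \<and> eccentricity F = eccentricity F' \<and> eccentricity F' \<noteq> 1"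
  shows "eccentricity F = eccentricity F'" "symmetry_axis F = symmetry_axis F'"
    "vertices F = vertices F'" "foci F = foci F'"
proof -
  have *: "eccentricity F = eccentricity F' \<and> symmetry_axis F = symmetry_axis F' \<and>
    vertices F = vertices F' \<and> foci F = foci F'"
  proof (cases "d = 0")
    case True
    then have axis: "symmetry_axis F = symmetry_axis F'" using F F' presents_0_axis by blast
    then have "vertices F = vertices F'"
      using presents_axis_Int[OF F] presents_axis_Int[OF F'] by simp
    moreover have "admissible F" "admissible F'" using F F' by (auto simp: presents_def)
    ultimately show ?thesis using d[OF True] axis by (auto simp: foci_eq)
  next
    case False
    then show ?thesis using presents_invariants_pos[OF F F'] by simp
  qed
  show "eccentricity F = eccentricity F'" "symmetry_axis F = symmetry_axis F'"
    "vertices F = vertices F'" "foci F = foci F'" using * by auto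
qed

section \<open>Central quadrics with exchanged foci and vertices\<close>

text \<open>With \<open>a = e * sqrt R\<close> and
  \<open>b\<^sup>2 = \<bar>R * (e\<^sup>2 - 1)\<bar>\<close>, both
  \<open>a\<^sup>2 - b\<^sup>2\<close> for \<open>e > 1\<close> and
  \<open>a\<^sup>2 + b\<^sup>2\<close> for \<open>e < 1\<close> equal R. So the foci are at distance
  \<open>sqrt R\<close> from the centre, and the eccentricity is \<open>1 / e\<close>.\<close>

lemma central_quadric:
  fixes q :: "nat \<Rightarrow> 'a::euclidean_space" and c :: 'a and e R :: real
  assumes e: "0 < e" "e \<noteq> 1" and R: "0 < R"
  defines "F \<equiv> (if e > 1 then Spheroid else Hyperboloid) c q (e * sqrt R) (sqrt \<bar>R * (e\<^sup>2 - 1)\<bar>)"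
  shows "admissible F" "eccentricity F = 1 / e" "linear_constant F = 0" "level_constant F = R * (e\<^sup>2 - 1)"
    "origin F = c" "axes F = q" "vertices F = {c + (e * sqrt R) *\<^sub>R q 0, c - (e * sqrt R) *\<^sub>R q 0}"
    "foci F = {c + sqrt R *\<^sub>R q 0, c - sqrt R *\<^sub>R q 0}"
proof -
  define a where "a = e * sqrt R"
  define b where "b = sqrt \<bar>R * (e\<^sup>2 - 1)\<bar>"
  have a: "a > 0" "a\<^sup>2 = e\<^sup>2 * R" using e R by (auto simp: a_def power_mult_distrib)
  have b2: "b\<^sup>2 = \<bar>R * (e\<^sup>2 - 1)\<bar>" by (simp add: b_def)
  have "R * (e\<^sup>2 - 1) \<noteq> 0" using R e by (simp add: power2_eq_1_iff)
  then have "b > 0" by (simp add: b_def)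
  have inv: "sqrt ((1 / e)\<^sup>2) = 1 / e" using e by (simp only: real_sqrt_abs) simp
  have ea: "1 / e * a = sqrt R" using e by (simp add: a_def)
  have "admissible F \<and> eccentricity F = 1 / e \<and> linear_constant F = 0 \<and> level_constant F = R * (e\<^sup>2 - 1) \<and>
    origin F = c \<and> axes F = q \<and> vertices F = {c + a *\<^sub>R q 0, c - a *\<^sub>R q 0} \<and>
    foci F = {c + (1 / e * a) *\<^sub>R q 0, c - (1 / e * a) *\<^sub>R q 0}"
  proof (cases "e > 1")
    case True
    then have F: "F = Spheroid c q a b" by (simp add: F_def a_def b_def)
    have "e\<^sup>2 - 1 > 0" using True by (simp add: one_less_power)
    then have b2: "b\<^sup>2 = R * (e\<^sup>2 - 1)" using b2 R by simp
    then have "b\<^sup>2 < a\<^sup>2" using a R by (simp add: algebra_simps)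
    then have "b < a" using a by (meson less_imp_le power2_less_imp_less)
    have "1 - (b / a)\<^sup>2 = (1 / e)\<^sup>2" using e R by (simp add: power_divide a b2 field_simps)
    then have ecc: "eccentricity F = 1 / e" unfolding F using inv by simp
    have "foci F = {c + (1 / e * a) *\<^sub>R q 0, c - (1 / e * a) *\<^sub>R q 0}"
      using ecc unfolding F by (simp only: foci.simps Let_def)
    then show ?thesis using ecc \<open>b < a\<close> \<open>b > 0\<close> b2 by (simp add: F)
  next
    case False
    then have F: "F = Hyperboloid c q a b" by (simp add: F_def a_def b_def)
    have "e\<^sup>2 - 1 < 0" using False e by (simp add: abs_square_less_1)
    then have b2: "b\<^sup>2 = - (R * (e\<^sup>2 - 1))" using b2 R by (simp add: abs_mult right_diff_distrib)
    have "1 + (b / a)\<^sup>2 = (1 / e)\<^sup>2" using e R by (simp add: power_divide a b2 field_simps)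
    then have ecc: "eccentricity F = 1 / e" unfolding F using inv by simp
    have "foci F = {c + (1 / e * a) *\<^sub>R q 0, c - (1 / e * a) *\<^sub>R q 0}"
      using ecc unfolding F by (simp only: foci.simps Let_def)
    then show ?thesis using ecc \<open>b > 0\<close> b2 a by (simp add: F)
  qed
  then show "admissible F" "eccentricity F = 1 / e" "linear_constant F = 0" "level_constant F = R * (e\<^sup>2 - 1)"
    "origin F = c" "axes F = q" "vertices F = {c + (e * sqrt R) *\<^sub>R q 0, c - (e * sqrt R) *\<^sub>R q 0}"
    "foci F = {c + sqrt R *\<^sub>R q 0, c - sqrt R *\<^sub>R q 0}"
    by (simp_all only: ea) (simp_all add: a_def)
qed

text \<open>Replacing e by \<open>1 / e\<close> and R by \<open>e\<^sup>2 * R\<close> in the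
  preceding lemma exchanges the distances \<open>sqrt R\<close> and \<open>e * sqrt R\<close>, keeps
  b and swaps the types.\<close>

lemma conjugate_central_quadric:
  fixes q :: "nat \<Rightarrow> 'a::euclidean_space" and c :: 'a and e R :: real
  assumes e: "0 < e" "e \<noteq> 1" and R: "0 < R"
  defines "G \<equiv> (if e > 1 then Hyperboloid else Spheroid) c q (sqrt R) (sqrt \<bar>R * (e\<^sup>2 - 1)\<bar>)"
  shows "admissible G" "eccentricity G = e" "linear_constant G = 0" "level_constant G = - (R * (e\<^sup>2 - 1))"
    "origin G = c" "axes G = q" "vertices G = {c + sqrt R *\<^sub>R q 0, c - sqrt R *\<^sub>R q 0}"
    "foci G = {c + (e * sqrt R) *\<^sub>R q 0, c - (e * sqrt R) *\<^sub>R q 0}"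
proof -
  have e': "0 < 1 / e" "1 / e \<noteq> 1" "0 < e\<^sup>2 * R" using e R by auto
  have sq: "sqrt (e\<^sup>2 * R) = e * sqrt R" using e by (simp add: real_sqrt_mult)
  have lev: "e\<^sup>2 * R * ((1 / e)\<^sup>2 - 1) = - (R * (e\<^sup>2 - 1))" using e by (simp add: power_divide field_simps)
  have G: "G = (if 1 / e > 1 then Spheroid else Hyperboloid) c q (1 / e * sqrt (e\<^sup>2 * R))
      (sqrt \<bar>e\<^sup>2 * R * ((1 / e)\<^sup>2 - 1)\<bar>)"
    unfolding lev sq using e by (auto simp: G_def)
  note C = central_quadric[OF e', of c q, folded G, unfolded sq lev]
  show "admissible G" "eccentricity G = e" "linear_constant G = 0" "level_constant G = - (R * (e\<^sup>2 - 1))"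
    "origin G = c" "axes G = q" "vertices G = {c + sqrt R *\<^sub>R q 0, c - sqrt R *\<^sub>R q 0}"
    "foci G = {c + (e * sqrt R) *\<^sub>R q 0, c - (e * sqrt R) *\<^sub>R q 0}"
    using C e by auto
qed

section \<open>Tangent spaces at vertices\<close>

text \<open>Differentiating the equation along a curve through the vertex shows that velocities are
  orthogonal to the axis, as the gradient there is a nonzero multiple of q. Conversely, each such
  direction is the velocity of an explicit curve.\<close>

lemma tangent_space_focal_set_vertex:
  fixes W :: "'a::euclidean_space set"
  assumes W: "subspace W" and q: "q \<in> W" "norm q = 1" and fc: "focal_constants \<epsilon> p \<sigma>"
    and \<xi>: "c + \<xi> *\<^sub>R q \<in> focal_set W c q \<epsilon> p \<sigma>"
  shows "tangent_space (focal_set W c q \<epsilon> p \<sigma>) (c + \<xi> *\<^sub>R q) = {z \<in> W. z \<bullet> q = 0}"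
proof (intro set_eqI iffI)
  let ?Q = "focal_set W c q \<epsilon> p \<sigma>"
  have eq_\<xi>: "(1 - \<epsilon>\<^sup>2) * \<xi>\<^sup>2 - 2 * p * \<xi> = \<sigma>" using \<xi> focal_set_axis_iff[OF W q] by blast
  have pos: "0 < \<epsilon>" using fc by (simp add: focal_constants_def)
  then have e1: "1 - \<epsilon>\<^sup>2 \<noteq> 0" if "\<epsilon> \<noteq> 1" using that by (simp add: power2_eq_1_iff)
  {
    fix z assume "z \<in> tangent_space ?Q (c + \<xi> *\<^sub>R q)"
    then obtain f \<delta> where \<delta>: "\<delta> > 0" and f0: "f 0 = c + \<xi> *\<^sub>R q" and fQ: "\<And>r. r \<in> {-\<delta><..<\<delta>} \<Longrightarrow> f r \<in> ?Q"
      and der: "(f has_vector_derivative z) (at 0)"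
      unfolding tangent_space_def by blast
    have ev: "eventually (\<lambda>r. r \<in> {-\<delta><..<\<delta>}) (nhds 0)"
      using \<delta> by (intro eventually_nhds_in_open) auto
    have zW: "z \<in> W"
    proof -
      have "y \<bullet> z = 0" if y: "y \<in> W\<^sup>\<bottom>" for y
      proof -
        have "((\<lambda>r. y \<bullet> (f r - c)) has_real_derivative y \<bullet> z) (at 0)"
          using der by (auto simp: has_vector_derivative_def has_field_derivative_def mult.commute
              intro!: derivative_eq_intros)
        moreover have "((\<lambda>r. y \<bullet> (f r - c)) has_real_derivative 0) (at 0)"
        proof (rule DERIV_cong_ev[THEN iffD2, OF refl _ refl])
          show "\<forall>\<^sub>F r in nhds 0. y \<bullet> (f r - c) = 0"
            using ev
          proof eventually_elim
            case (elim r)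
            then have "f r - c \<in> W" using fQ by (simp add: focal_set_def)
            then show ?case using y by (auto simp: orthogonal_comp_def orthogonal_def inner_commute)
          qed
        qed simp
        ultimately show ?thesis by (rule DERIV_unique)
      qed
      then have "z \<in> W\<^sup>\<bottom>\<^sup>\<bottom>" by (auto simp: orthogonal_comp_def orthogonal_def)
      then show ?thesis using orthogonal_comp_self[OF W] by simp
    qed
    have "((\<lambda>r. (f r - c) \<bullet> (f r - c) - \<epsilon>\<^sup>2 * ((f r - c) \<bullet> q)\<^sup>2 - 2 * p * ((f r - c) \<bullet> q)) has_real_derivative
        2 * (((1 - \<epsilon>\<^sup>2) * \<xi> - p) * (z \<bullet> q))) (at 0)"
    proof -
      have d1: "((\<lambda>r. (f r - c) \<bullet> q) has_real_derivative z \<bullet> q) (at 0)"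
        using der by (auto simp: has_vector_derivative_def has_field_derivative_def mult.commute
            intro!: derivative_eq_intros)
      have d2: "((\<lambda>r. (f r - c) \<bullet> (f r - c)) has_real_derivative 2 * ((f 0 - c) \<bullet> z)) (at 0)"
        using der by (auto simp: has_vector_derivative_def has_field_derivative_def inner_commute
            intro!: derivative_eq_intros)
      show ?thesis
        by (rule DERIV_cong[OF DERIV_diff[OF DERIV_diff[OF d2 DERIV_cmult[OF DERIV_power[OF d1, of 2]]]
          DERIV_cmult[OF d1]]]) (use q in \<open>simp add: f0 norm_eq_1 inner_commute algebra_simps\<close>)
    qed
    moreover have "((\<lambda>r. (f r - c) \<bullet> (f r - c) - \<epsilon>\<^sup>2 * ((f r - c) \<bullet> q)\<^sup>2 - 2 * p * ((f r - c) \<bullet> q)) has_real_derivative 0) (at 0)"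
    proof (rule DERIV_cong_ev[THEN iffD2, OF refl _ refl])
      show "\<forall>\<^sub>F r in nhds 0. (f r - c) \<bullet> (f r - c) - \<epsilon>\<^sup>2 * ((f r - c) \<bullet> q)\<^sup>2 - 2 * p * ((f r - c) \<bullet> q) = \<sigma>"
        using ev by eventually_elim (use fQ in \<open>auto simp: focal_set_def\<close>)
    qed simp
    ultimately have "((1 - \<epsilon>\<^sup>2) * \<xi> - p) * (z \<bullet> q) = 0" using DERIV_unique by fastforce
    \<comment> \<open>The axial derivative at the vertex: it is -p for a paraboloid; otherwise p =
      0, and \<xi> cannot vanish because \<sigma> does not.\<close>
    moreover have "(1 - \<epsilon>\<^sup>2) * \<xi> - p \<noteq> 0"
    proof (cases "\<epsilon> = 1")
      case True
      then show ?thesis using fc by (auto simp: focal_constants_def)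
    next
      case False
      then have "p = 0" "\<sigma> \<noteq> 0" using fc by (auto simp: focal_constants_def)
      then show ?thesis using eq_\<xi> e1[OF False] by auto
    qed
    ultimately show "z \<in> {z \<in> W. z \<bullet> q = 0}" using zW by simp
  }
  {
    fix z assume "z \<in> {z \<in> W. z \<bullet> q = 0}"
    then have z: "z \<in> W" "z \<bullet> q = 0" by auto
    \<comment> \<open>The curve moves by \<open>r *\<^sub>R z\<close> across the axis, and
      \<open>\<phi> r\<close> is the axial coordinate that keeps it on the quadric. Its derivative
      vanishes at 0, so the velocity is exactly z. For a paraboloid the condition is linear in
      \<open>\<phi> r\<close>.\<close>
    obtain \<phi> \<phi>' \<delta> where \<delta>: "\<delta> > 0" and \<phi>: "\<phi> 0 = \<xi>" "\<phi>' 0 = 0" "continuous_on {-\<delta><..<\<delta>} \<phi>'"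
      "\<And>r. r \<in> {-\<delta><..<\<delta>} \<Longrightarrow> (\<phi> has_real_derivative \<phi>' r) (at r)"
      "\<And>r. r \<in> {-\<delta><..<\<delta>} \<Longrightarrow> (1 - \<epsilon>\<^sup>2) * (\<phi> r)\<^sup>2 - 2 * p * \<phi> r + r\<^sup>2 * (z \<bullet> z) = \<sigma>"
    proof (cases "\<epsilon> = 1")
      case True
      then have p: "p \<noteq> 0" "\<sigma> = 0" using fc by (auto simp: focal_constants_def)
      show thesis
      proof (rule that[of 1 "\<lambda>r. r\<^sup>2 * (z \<bullet> z) / (2 * p)" "\<lambda>r. r * (z \<bullet> z) / p"])
        show "((\<lambda>r. r\<^sup>2 * (z \<bullet> z) / (2 * p)) has_real_derivative r * (z \<bullet> z) / p) (at r)" for r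
          using p by (auto intro!: derivative_eq_intros)
      qed (use p True eq_\<xi> in \<open>auto intro!: continuous_intros\<close>)
    next
      case False
      then have p: "p = 0" "\<sigma> \<noteq> 0" using fc by (auto simp: focal_constants_def)
      \<comment> \<open>By \<open>eq_\<xi>\<close> the condition becomes
        \<open>(\<phi> r)\<^sup>2 = \<xi>\<^sup>2 * (1 - K * r\<^sup>2)\<close>. The radius \<delta>
        is at most 1, hence \<open>\<bar>K\<bar> * r\<^sup>2 \<le> \<bar>K\<bar> * \<bar>r\<bar> <
        1\<close> and the root is smooth.\<close>
      define K where "K = (z \<bullet> z) / \<sigma>"
      define \<delta> where "\<delta> = 1 / (1 + \<bar>K\<bar>)"
      have \<delta>: "\<delta> > 0" "\<delta> \<le> 1" by (auto simp: \<delta>_def add_pos_nonneg)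
      have less: "0 < 1 - K * r\<^sup>2" if "r \<in> {-\<delta><..<\<delta>}" for r
      proof -
        have r: "\<bar>r\<bar> < \<delta>" "\<bar>r\<bar> \<le> 1" using that \<delta> by auto
        have r2: "\<bar>r\<bar>\<^sup>2 \<le> \<bar>r\<bar>"
          unfolding power2_eq_square using r by (intro mult_left_le) auto
        have "K * r\<^sup>2 \<le> \<bar>K\<bar> * \<bar>r\<bar>\<^sup>2" by (simp add: mult_right_mono)
        also have "\<dots> \<le> \<bar>K\<bar> * \<bar>r\<bar>" using r2 by (intro mult_left_mono) auto
        also have "\<dots> \<le> \<bar>K\<bar> * \<delta>" using r by (intro mult_left_mono) auto
        also have "\<dots> < 1" by (simp add: \<delta>_def divide_less_eq)
        finally show ?thesis by simp
      qed
      show thesis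
      proof (rule that[of \<delta> "\<lambda>r. \<xi> * sqrt (1 - K * r\<^sup>2)" "\<lambda>r. - \<xi> * K * r / sqrt (1 - K * r\<^sup>2)"])
        fix r assume "r \<in> {-\<delta><..<\<delta>}"
        note l = less[OF this]
        show "((\<lambda>r. \<xi> * sqrt (1 - K * r\<^sup>2)) has_real_derivative - \<xi> * K * r / sqrt (1 - K * r\<^sup>2)) (at r)"
          using l by (auto intro!: derivative_eq_intros simp: field_simps)
        have "(1 - \<epsilon>\<^sup>2) * (\<xi> * sqrt (1 - K * r\<^sup>2))\<^sup>2 = ((1 - \<epsilon>\<^sup>2) * \<xi>\<^sup>2) * (1 - K * r\<^sup>2)"
          using l by (simp add: power_mult_distrib)
        also have "\<dots> = \<sigma> * (1 - K * r\<^sup>2)" using eq_\<xi> p by simp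
        also have "\<dots> = \<sigma> - r\<^sup>2 * (z \<bullet> z)" using p by (simp add: K_def field_simps)
        finally show "(1 - \<epsilon>\<^sup>2) * (\<xi> * sqrt (1 - K * r\<^sup>2))\<^sup>2 - 2 * p * (\<xi> * sqrt (1 - K * r\<^sup>2)) + r\<^sup>2 * (z \<bullet> z) = \<sigma>"
          using p by simp
      next
        show "continuous_on {-\<delta><..<\<delta>} (\<lambda>r. - \<xi> * K * r / sqrt (1 - K * r\<^sup>2))"
          using less by (intro continuous_intros) fastforce
      qed (use \<delta> in auto)
    qed
    define f where "f r = c + \<phi> r *\<^sub>R q + r *\<^sub>R z" for r
    have der: "(f has_vector_derivative \<phi>' r *\<^sub>R q + z) (at r)" if "r \<in> {-\<delta><..<\<delta>}" for r
      unfolding f_def using \<phi>(4)[OF that]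
      by (auto intro!: derivative_eq_intros simp: has_real_derivative_iff_has_vector_derivative)
    show "z \<in> tangent_space ?Q (c + \<xi> *\<^sub>R q)"
      unfolding tangent_space_def mem_Collect_eq
    proof (intro exI conjI)
      show "0 < \<delta>" by (rule \<delta>)
      show "f 0 = c + \<xi> *\<^sub>R q" by (simp add: f_def \<phi>)
      show "\<forall>r\<in>{-\<delta><..<\<delta>}. f r \<in> ?Q"
      proof
        fix r assume r: "r \<in> {-\<delta><..<\<delta>}"
        have "f r - c = \<phi> r *\<^sub>R q + r *\<^sub>R z" by (simp add: f_def)
        moreover have "\<phi> r *\<^sub>R q + r *\<^sub>R z \<in> W" using W q z by (simp add: subspace_add subspace_scale)
        moreover have "(\<phi> r *\<^sub>R q + r *\<^sub>R z) \<bullet> (\<phi> r *\<^sub>R q + r *\<^sub>R z) = (\<phi> r)\<^sup>2 + r\<^sup>2 * (z \<bullet> z)"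
          "(\<phi> r *\<^sub>R q + r *\<^sub>R z) \<bullet> q = \<phi> r"
          using q z by (auto simp: norm_eq_1 inner_add_left inner_add_right inner_commute power2_eq_square)
        ultimately show "f r \<in> ?Q" using \<phi>(5)[OF r] by (simp add: focal_set_def left_diff_distrib)
      qed
      show "f C1_differentiable_on {-\<delta><..<\<delta>}"
        unfolding C1_differentiable_on_def using der \<phi>(3)
        by (intro exI[of _ "\<lambda>r. \<phi>' r *\<^sub>R q + z"]) (auto intro!: continuous_intros)
      show "(f has_vector_derivative z) (at 0)" using der[of 0] \<delta> \<phi>(2) by simp
    qed
  }
qed

section \<open>General position and the linear systems for \<open>v\<close> and
  \<open>u\<close>\<close>

text \<open>A set of c points has affine dimension at most c - 1, so dimension m - 1 forces the m
  points to be distinct and affinely independent.\<close>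

lemma general_position_imp:
  fixes s :: "nat \<Rightarrow> 'a::euclidean_space"
  assumes gp: "aff_dim (s ` {1..m}) = int m - 1" and m: "1 \<le> m"
  defines "U \<equiv> span {s i - s 1 | i. i \<in> {2..m}}"
  shows "inj_on s {1..m}" "affine hull (s ` {1..m}) = (+) (s 1) ` U" "dim U = m - 1"
    "independent ((\<lambda>i. s i - s 1) ` {2..m})"
proof -
  have "int m - 1 \<le> int (card (s ` {1..m})) - 1" using aff_dim_le_card[of "s ` {1..m}"] gp by simp
  moreover have "card (s ` {1..m}) \<le> m" using card_image_le[of "{1..m}" s] by simp
  ultimately have card: "card (s ` {1..m}) = m" by simp
  then show inj: "inj_on s {1..m}" by (simp add: eq_card_imp_inj_on)
  have indep: "\<not> affine_dependent (s ` {1..m})"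
    unfolding affine_independent_iff_card using card gp by simp
  have s1: "s 1 \<in> s ` {1..m}" using m by auto
  have "{1..m} - {1} = {2..m}" by auto
  then have "s ` {1..m} - {s 1} = s ` {2..m}"
    using inj_on_image_set_diff[OF inj, of "{1..m}" "{1}"] m by auto
  then have image: "(\<lambda>x. - s 1 + x) ` (s ` {1..m} - {s 1}) = (\<lambda>i. s i - s 1) ` {2..m}"
    by (simp add: image_image)
  show "independent ((\<lambda>i. s i - s 1) ` {2..m})"
    using indep affine_dependent_iff_dependent2[OF s1] image by simp
  have U: "U = span ((\<lambda>i. s i - s 1) ` {2..m})"
    unfolding U_def by (rule arg_cong[of _ _ span]) auto
  show hull: "affine hull (s ` {1..m}) = (+) (s 1) ` U"
    using affine_hull_span2[OF s1] image U by simp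
  have "aff_dim (s ` {1..m}) = int (dim U)"
    by (metis U hull aff_dim_affine_hull aff_dim_subspace aff_dim_translation_eq subspace_span)
  then show "dim U = m - 1" using gp m by simp
qed

text \<open>Covers both defining systems, with r = 2 for v and r = 1 for u. Differences with the
  first equation prescribe a functional on a basis of U, the remaining equations prescribe the
  component in \<open>U\<^sup>\<bottom>\<close>, and the first equation then fixes a.\<close>

lemma ex1_linear_system:
  fixes s w :: "nat \<Rightarrow> 'a::euclidean_space" and r :: real
  assumes gp: "aff_dim (s ` {1..m}) = int m - 1" and m: "1 \<le> m" and r: "r \<noteq> 0"
    and U: "U = span {s i - s 1 | i. i \<in> {2..m}}"
    and w: "orthonormal_basis {1..k} w (U\<^sup>\<bottom>)"
  shows "\<exists>!(x, a). (\<forall>i\<in>{1..m}. r * (s i \<bullet> x) - a = c i) \<and> (\<forall>j\<in>{1..k}. x \<bullet> w j = d j)"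
proof -
  have subU: "subspace U" by (simp add: U)
  have inj: "inj_on s {1..m}" by (rule general_position_imp(1)[OF gp m])
  have sU: "s i - s 1 \<in> U" if "i \<in> {1..m}" for i
  proof (cases "i = 1")
    case False
    then show ?thesis using that unfolding U by (intro span_base) auto
  qed (use subspace_0[OF subU] in simp)
  have wU: "x \<bullet> w j = 0" if "x \<in> U" "j \<in> {1..k}" for x j
    using orthonormal_basis_in[OF w that(2)] that(1) by (auto simp: orthogonal_comp_def orthogonal_def)
  \<comment> \<open>The prescribed value at \<open>s i - s 1\<close>; the index is recovered from
    the vector by injectivity of s. Below, \<open>adjoint g 1\<close> is the vector representing the
    linear extension g.\<close>
  define f where "f y = (c (inv_into {1..m} s (s 1 + y)) - c 1) / r" for y
  obtain g where g: "linear g" "\<And>x. x \<in> (\<lambda>i. s i - s 1) ` {2..m} \<Longrightarrow> g x = f x"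
    using linear_independent_extend[OF general_position_imp(4)[OF gp m], of f] by blast
  define y where "y = adjoint g 1"
  have y: "(s i - s 1) \<bullet> y = (c i - c 1) / r" if "i \<in> {1..m}" for i
  proof (cases "i = 1")
    case False
    have "(s i - s 1) \<bullet> y = g (s i - s 1)" by (simp add: y_def adjoint_works[OF g(1)])
    also have "\<dots> = f (s i - s 1)" using False that by (intro g(2)) auto
    also have "\<dots> = (c i - c 1) / r" using inv_into_f_f[OF inj that] by (simp add: f_def)
    finally show ?thesis .
  qed simp
  \<comment> \<open>Only inner products with U are prescribed by y, so its component in
    \<open>U\<^sup>\<bottom>\<close> may be exchanged for the one with coefficients d.\<close>
  have "y \<in> U + U\<^sup>\<bottom>" using subspace_sum_orthogonal_comp[OF subU] by simp
  then obtain yU y' where yy: "y = yU + y'" "yU \<in> U" "y' \<in> U\<^sup>\<bottom>" by (rule set_plus_elim)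
  define z where "z = (\<Sum>j\<in>{1..k}. d j *\<^sub>R w j)"
  define x where "x = yU + z"
  define a where "a = r * (s 1 \<bullet> x) - c 1"
  have "z \<in> U\<^sup>\<bottom>" using orthonormal_basis_in_iff[OF w] by (auto simp: z_def)
  have sol1: "r * (s i \<bullet> x) - a = c i" if i: "i \<in> {1..m}" for i
  proof -
    have "(s i - s 1) \<bullet> x = (s i - s 1) \<bullet> y"
      using sU[OF i] yy \<open>z \<in> U\<^sup>\<bottom>\<close> by (auto simp: x_def inner_add_right orthogonal_comp_def orthogonal_def)
    then have "r * ((s i - s 1) \<bullet> x) = c i - c 1" using y[OF i] r by simp
    then show ?thesis by (simp add: a_def inner_diff_left algebra_simps)
  qed
  have sol2: "x \<bullet> w j = d j" if "j \<in> {1..k}" for j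
    using orthonormal_basis_inner_sum[OF w, of "{1..k}" j d] that wU[OF yy(2) that]
    by (simp add: x_def z_def inner_add_left)
  have uniq: "x1 = x2 \<and> a1 = a2"
    if 1: "\<forall>i\<in>{1..m}. r * (s i \<bullet> x1) - a1 = c i" "\<forall>j\<in>{1..k}. x1 \<bullet> w j = d j"
      and 2: "\<forall>i\<in>{1..m}. r * (s i \<bullet> x2) - a2 = c i" "\<forall>j\<in>{1..k}. x2 \<bullet> w j = d j" for x1 x2 a1 a2
  proof -
    have r12: "r * (s i \<bullet> (x1 - x2)) = a1 - a2" if "i \<in> {1..m}" for i
      using 1(1) 2(1) that by (force simp: inner_diff_right algebra_simps)
    have diff: "(x1 - x2) \<bullet> (s i - s 1) = 0" if "i \<in> {2..m}" for i
    proof -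
      have "r * (s i \<bullet> (x1 - x2)) = r * (s 1 \<bullet> (x1 - x2))" using r12[of i] r12[of 1] that by auto
      then have "s i \<bullet> (x1 - x2) = s 1 \<bullet> (x1 - x2)" using r by simp
      then show ?thesis by (simp only: inner_commute[of "x1 - x2"] inner_diff_left[of "s i"])
    qed
    have "orthogonal (x1 - x2) z" if "z \<in> U" for z
      using that unfolding U
    proof (rule orthogonal_to_span)
      fix y assume "y \<in> {s i - s 1 | i. i \<in> {2..m}}"
      then show "orthogonal (x1 - x2) y" unfolding orthogonal_def using diff by blast
    qed
    then have "(x1 - x2) \<in> U\<^sup>\<bottom>" by (simp add: orthogonal_comp_def orthogonal_commute)
    moreover have "(x1 - x2) \<in> U\<^sup>\<bottom>\<^sup>\<bottom>"
    proof -
      have w0: "(x1 - x2) \<bullet> w j = 0" if "j \<in> {1..k}" for j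
        using 1(2) 2(2) that by (simp add: inner_diff_left)
      have "orthogonal (x1 - x2) z" if "z \<in> span (w ` {1..k})" for z
        by (rule orthogonal_to_span[OF that]) (auto simp: orthogonal_def w0)
      then show ?thesis
        using orthonormal_basisD(2)[OF w] by (simp add: orthogonal_comp_def orthogonal_commute)
    qed
    ultimately have "x1 - x2 \<in> {0}"
      using orthogonal_Int_0[OF subspace_orthogonal_comp[of U]] by blast
    then have "x1 = x2" by simp
    then show ?thesis using r12[of 1] m by simp
  qed
  show ?thesis
  proof (rule ex1I[of _ "(x, a)"])
    show "case (x, a) of (x, a) \<Rightarrow>
        (\<forall>i\<in>{1..m}. r * (s i \<bullet> x) - a = c i) \<and> (\<forall>j\<in>{1..k}. x \<bullet> w j = d j)"
      using sol1 sol2 by simp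
  next
    fix y assume y: "case y of (x, a) \<Rightarrow>
        (\<forall>i\<in>{1..m}. r * (s i \<bullet> x) - a = c i) \<and> (\<forall>j\<in>{1..k}. x \<bullet> w j = d j)"
    obtain y1 y2 where "y = (y1, y2)" by fastforce
    then show "y = (x, a)" using y uniq[of y1 y2 x a] sol1 sol2 by simp
  qed
qed

lemma pair_eq_The:
  assumes "(x, a) = (THE (x, a). P x a)" "\<exists>!(x, a). P x a"
  shows "P x a"
  using theI'[OF assms(2)] assms(1)[symmetric] by simp

section \<open>Passing from coordinates along \<open>u\<close> to the normal form\<close>

text \<open>Used for both quadrics, with V the complement of u in the respective direction space.
  Since u is not normalised, the axial coordinate is \<open>norm u * (b - \<tau>)\<close>, which
  explains the powers of \<open>norm u\<close>.\<close>

lemma quadric_eq_focal_set: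
  fixes V :: "'a::euclidean_space set"
  assumes V: "\<And>x. x \<in> V \<Longrightarrow> x \<bullet> u = 0" "subspace V" and u: "u \<noteq> 0"
    and \<psi>: "\<And>b. \<psi> b = (norm u)\<^sup>2 * (1 - \<epsilon>\<^sup>2) * (b - \<tau>)\<^sup>2 - 2 * p * norm u * (b - \<tau>) - \<sigma>"
  shows "{v + b *\<^sub>R u + x | b x. x \<in> V \<and> x \<bullet> x + \<psi> b = 0} =
    focal_set (span (insert u V)) (v + \<tau> *\<^sub>R u) (u /\<^sub>R norm u) \<epsilon> p \<sigma>"
proof -
  have iff: "v + b *\<^sub>R u + x \<in> focal_set (span (insert u V)) (v + \<tau> *\<^sub>R u) (u /\<^sub>R norm u) \<epsilon> p \<sigma> \<longleftrightarrow> x \<bullet> x + \<psi> b = 0"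
    if x: "x \<in> V" for b x
  proof -
    define z where "z = v + b *\<^sub>R u + x - (v + \<tau> *\<^sub>R u)"
    have z: "z = (b - \<tau>) *\<^sub>R u + x" by (simp add: z_def algebra_simps)
    have zW: "z \<in> span (insert u V)" unfolding z using x by (intro span_add span_scale span_base) auto
    have zz: "z \<bullet> z = (norm u)\<^sup>2 * (b - \<tau>)\<^sup>2 + x \<bullet> x"
      unfolding power2_norm_eq_inner
      using V(1)[OF x] by (simp add: z inner_add_left inner_add_right inner_commute power2_eq_square)
    have zq: "z \<bullet> (u /\<^sub>R norm u) = norm u * (b - \<tau>)"
    proof -
      have "u \<bullet> u = norm u * norm u" by (metis power2_norm_eq_inner power2_eq_square)
      moreover have "z \<bullet> u = (b - \<tau>) * (u \<bullet> u)"
        using V(1)[OF x] by (simp add: z inner_add_left)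
      ultimately have "z \<bullet> u = norm u * (norm u * (b - \<tau>))" by (simp only: mult_ac)
      then show ?thesis using u by simp
    qed
    show ?thesis
      unfolding focal_set_def mem_Collect_eq z_def[symmetric] zz zq \<psi>
        power_mult_distrib[of "norm u"]
      using zW by (simp add: algebra_simps)
  qed
  show ?thesis
  proof (intro set_eqI iffI)
    fix y assume y: "y \<in> focal_set (span (insert u V)) (v + \<tau> *\<^sub>R u) (u /\<^sub>R norm u) \<epsilon> p \<sigma>"
    then obtain a where "y - (v + \<tau> *\<^sub>R u) - a *\<^sub>R u \<in> span V"
      unfolding focal_set_def span_insert by auto
    moreover define x where "x = y - (v + \<tau> *\<^sub>R u) - a *\<^sub>R u"
    ultimately have x: "x \<in> V" by (simp add: span_eq_iff[THEN iffD2, OF V(2)])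
    have y_eq: "y = v + (\<tau> + a) *\<^sub>R u + x" by (simp add: x_def algebra_simps)
    have "x \<bullet> x + \<psi> (\<tau> + a) = 0" using iff[OF x] y unfolding y_eq by blast
    then show "y \<in> {v + b *\<^sub>R u + x | b x. x \<in> V \<and> x \<bullet> x + \<psi> b = 0}"
      using x y_eq by blast
  qed (auto simp: iff)
qed

lemma span_insert_scaleR: "c \<noteq> 0 \<Longrightarrow> span (insert (c *\<^sub>R x) S) = span (insert x S)" for x :: "'a::real_vector"
proof -
  assume c: "c \<noteq> 0"
  have "x \<in> span (insert (c *\<^sub>R x) S)"
    using span_scale[of "c *\<^sub>R x" "insert (c *\<^sub>R x) S" "1 / c"] c by (simp add: span_base)
  moreover have "c *\<^sub>R x \<in> span (insert x S)" by (intro span_scale span_base) simp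
  ultimately show ?thesis
    by (intro span_eq[THEN iffD2] conjI) (auto intro: span_base)
qed

lemma span_insert_span: "span (insert x (span S)) = span (insert x S)" for x :: "'a::real_vector"
  by (simp add: span_insert span_span)

text \<open>Turns the signed squares in the definitions of g and h into plain polynomials.\<close>

lemma sgn_sqrt: "sgn x * (c * sqrt \<bar>x\<bar> * y)\<^sup>2 = c\<^sup>2 * (x * y\<^sup>2)" for x c y :: real
  by (simp add: power_mult_distrib sgn_if)

text \<open>In both applications the relevant vectors of W1 lie in \<open>U\<^sup>\<bottom>\<close>
  and W2 is U, so orthogonality holds against all of W2 and not merely against a complement in it.
  The point p is common to the two translates.\<close>

lemma perpendicular_translations:
  fixes W1 W2 :: "'a::euclidean_space set"
  assumes W: "subspace W1" "subspace W2" and p: "p - a \<in> W1" "p - b \<in> W2"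
    and orth: "\<And>x y. x \<in> W1 \<Longrightarrow> y \<in> W2 \<Longrightarrow> (\<And>z. z \<in> W1 \<inter> W2 \<Longrightarrow> x \<bullet> z = 0) \<Longrightarrow> x \<bullet> y = 0"
  shows "perpendicular ((+) a ` W1) ((+) b ` W2)"
proof -
  have "p \<in> (+) a ` W1 \<inter> (+) b ` W2" using p by (simp add: mem_translation_iff)
  then show ?thesis
    using orth W unfolding perpendicular_def orth_complement_in_def direction_space_translation[OF W(1)]
      direction_space_translation[OF W(2)] orthogonal_def
    by (auto intro: affine_translation_subspace)
qed

lemma orthonormal_coordinates:
  fixes q :: "nat \<Rightarrow> 'a::euclidean_space" and u v :: 'a
  assumes W: "orthonormal_basis {1..d} q W"
  shows "{v + b *\<^sub>R u + x | b x. x \<in> W \<and> x \<bullet> x + \<psi> b = 0} =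
    {v + y 0 *\<^sub>R u + (\<Sum>j=1..d. y j *\<^sub>R q j) | y. (\<Sum>j=1..d. (y j)\<^sup>2) + \<psi> (y 0) = 0}"
proof (intro set_eqI iffI)
  fix z assume "z \<in> {v + b *\<^sub>R u + x | b x. x \<in> W \<and> x \<bullet> x + \<psi> b = 0}"
  then obtain b x where bx: "z = v + b *\<^sub>R u + x" "x \<in> W" "x \<bullet> x + \<psi> b = 0" by blast
  obtain y where "x = (\<Sum>j=1..d. y j *\<^sub>R q j)"
    using orthonormal_basis_in_iff[OF W finite_atLeastAtMost, of x] bx(2) by blast
  with bx have z: "z = v + b *\<^sub>R u + (\<Sum>j=1..d. y j *\<^sub>R q j)"
    and eq: "(\<Sum>j=1..d. y j *\<^sub>R q j) \<bullet> (\<Sum>j=1..d. y j *\<^sub>R q j) + \<psi> b = 0" by simp_all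
  \<comment> \<open>Index 0 is outside the sums and carries the coordinate along u.\<close>
  define y' where "y' = y(0 := b)"
  have "(\<Sum>j=1..d. y' j *\<^sub>R q j) = (\<Sum>j=1..d. y j *\<^sub>R q j)" "(\<Sum>j=1..d. (y' j)\<^sup>2) = (\<Sum>j=1..d. (y j)\<^sup>2)"
    "y' 0 = b"
    by (auto simp: y'_def intro!: sum.cong)
  then have "z = v + y' 0 *\<^sub>R u + (\<Sum>j=1..d. y' j *\<^sub>R q j)" "(\<Sum>j=1..d. (y' j)\<^sup>2) + \<psi> (y' 0) = 0"
    using z eq orthonormal_basis_inner_self[OF W, of "{1..d}" y] by simp_all
  then show "z \<in> {v + y 0 *\<^sub>R u + (\<Sum>j=1..d. y j *\<^sub>R q j) | y. (\<Sum>j=1..d. (y j)\<^sup>2) + \<psi> (y 0) = 0}" by blast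
next
  fix z assume "z \<in> {v + y 0 *\<^sub>R u + (\<Sum>j=1..d. y j *\<^sub>R q j) | y. (\<Sum>j=1..d. (y j)\<^sup>2) + \<psi> (y 0) = 0}"
  then obtain y where y: "z = v + y 0 *\<^sub>R u + (\<Sum>j=1..d. y j *\<^sub>R q j)" "(\<Sum>j=1..d. (y j)\<^sup>2) + \<psi> (y 0) = 0"
    by blast
  then have "(\<Sum>j=1..d. y j *\<^sub>R q j) \<bullet> (\<Sum>j=1..d. y j *\<^sub>R q j) + \<psi> (y 0) = 0"
    using orthonormal_basis_inner_self[OF W, of "{1..d}" y] by simp
  moreover have "(\<Sum>j=1..d. y j *\<^sub>R q j) \<in> W"
    using orthonormal_basis_in_iff[OF W finite_atLeastAtMost] by blast
  ultimately show "z \<in> {v + b *\<^sub>R u + x | b x. x \<in> W \<and> x \<bullet> x + \<psi> b = 0}"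
    using y(1) by blast
qed

section \<open>The system of equations\<close>

text \<open>States the pairs (v, \<beta>) and (u, \<alpha>) through their equations, so that the
  description operator is eliminated once, on interpretation.\<close>

locale satellite_system =
  fixes m k :: nat and s w w' :: "nat \<Rightarrow> 'a::euclidean_space" and t :: "nat \<Rightarrow> real"
    and U :: "'a set" and u v :: 'a and \<alpha> \<beta> e :: real
  assumes m1: "1 \<le> m"
    and general_position: "aff_dim (s ` {1..m}) = int m - 1"
    and t_not_all_equal: "\<exists>i\<in>{1..m}. \<exists>j\<in>{1..m}. t i \<noteq> t j"
    and two_solutions: "\<exists>p\<in>solution_set m s t. \<exists>q\<in>solution_set m s t. p \<noteq> q"
    and nondegenerate: "m > 2 \<or> \<bar>t 1 - t 2\<bar> \<noteq> norm (s 1 - s 2)"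
    and U_def: "U = span {s i - s 1 | i. i \<in> {2..m}}"
    and w: "orthonormal_basis {1..k} w (U\<^sup>\<bottom>)"
    and v_eq: "\<And>i. i \<in> {1..m} \<Longrightarrow> 2 * (s i \<bullet> v) - \<beta> = (norm (s i))\<^sup>2 - (t i)\<^sup>2"
    and v_w: "\<And>j. j \<in> {1..k} \<Longrightarrow> v \<bullet> w j = s 1 \<bullet> w j"
    and u_eq: "\<And>i. i \<in> {1..m} \<Longrightarrow> s i \<bullet> u - \<alpha> = t i"
    and u_w: "\<And>j. j \<in> {1..k} \<Longrightarrow> u \<bullet> w j = 0"
    and e_def: "e = norm u"
    and w': "orthonormal_basis {0..m - 2} (\<lambda>i. if i = 0 then u /\<^sub>R e else w' i) U"
begin

definition "\<kappa> = u \<bullet> v - \<alpha>"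
definition "C = v \<bullet> v - \<beta>"
definition "\<mu> = \<kappa> / (e\<^sup>2 - 1)"
definition "\<rho> = \<kappa>\<^sup>2 / (e\<^sup>2 - 1) - C"
definition "lam1 = - C / (2 * \<kappa>)"
definition "lam2 = lam1 - \<kappa> / 2"
definition "V = span (w' ` {1..m - 2})"

text \<open>Here b is at once the time offset of a solution and its coordinate along u; the
  polynomial is what the system leaves besides the squared norm of the component in
  \<open>U\<^sup>\<bottom>\<close>.\<close>

definition sol_poly :: "real \<Rightarrow> real" where
  "sol_poly b = (e\<^sup>2 - 1) * b\<^sup>2 + 2 * \<kappa> * b + C"

text \<open>Arises from the relation between \<open>s i - v\<close> and \<open>t i\<close> by
  writing \<open>s i - v\<close> as \<open>b *\<^sub>R u + x\<close> with x in V; then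
  \<open>e\<^sup>2 * b\<close> is the inner product with u.\<close>

definition sat_poly :: "real \<Rightarrow> real" where
  "sat_poly b = e\<^sup>2 * b\<^sup>2 - (\<kappa> + e\<^sup>2 * b)\<^sup>2 - C"

lemma m2: "2 \<le> m"
proof (rule ccontr)
  assume "\<not> 2 \<le> m"
  then have "m = 1" using m1 by simp
  then show False using t_not_all_equal by auto
qed

lemma subspace_U: "subspace U" by (simp add: U_def)

lemma in_U_iff: "x \<in> U \<longleftrightarrow> (\<forall>j\<in>{1..k}. x \<bullet> w j = 0)"
proof
  assume "x \<in> U"
  then show "\<forall>j\<in>{1..k}. x \<bullet> w j = 0"
    using orthonormal_basis_in[OF w] by (auto simp: orthogonal_comp_def orthogonal_def)
next
  assume x: "\<forall>j\<in>{1..k}. x \<bullet> w j = 0"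
  have "orthogonal x z" if "z \<in> span (w ` {1..k})" for z
    by (rule orthogonal_to_span[OF that]) (use x in \<open>auto simp: orthogonal_def\<close>)
  then have "x \<in> U\<^sup>\<bottom>\<^sup>\<bottom>"
    using orthonormal_basisD(2)[OF w] by (simp add: orthogonal_comp_def orthogonal_commute)
  then show "x \<in> U" using orthogonal_comp_self[OF subspace_U] by simp
qed

lemma orth_U: "x \<in> U \<Longrightarrow> y \<in> U\<^sup>\<bottom> \<Longrightarrow> x \<bullet> y = 0"
  by (simp add: orthogonal_comp_def orthogonal_def)

lemma u_in_U: "u \<in> U" using in_U_iff u_w by simp

lemma u_nz: "u \<noteq> 0"
proof
  assume "u = 0"
  then have "t i = - \<alpha>" if "i \<in> {1..m}" for i using u_eq[OF that] by simp
  then show False using t_not_all_equal by auto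
qed

lemma e_pos: "0 < e" using u_nz by (simp add: e_def)

lemma u_u: "u \<bullet> u = e\<^sup>2" by (simp add: e_def power2_norm_eq_inner)

lemma s_diff_in_U: "i \<in> {1..m} \<Longrightarrow> s i - s 1 \<in> U"
proof (cases "i = 1")
  case True
  then show ?thesis using subspace_0[OF subspace_U] by simp
next
  case False
  assume "i \<in> {1..m}"
  then show ?thesis unfolding U_def using False by (intro span_base) auto
qed

lemma s_v_in_U: "s i - v \<in> U" if "i \<in> {1..m}" for i
proof -
  have "s 1 - v \<in> U" unfolding in_U_iff using v_w by (simp add: inner_diff_left)
  then show ?thesis using subspace_add[OF subspace_U s_diff_in_U[OF that]] by fastforce
qed

lemma t_eq: "i \<in> {1..m} \<Longrightarrow> t i = \<kappa> + (s i - v) \<bullet> u"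
  using u_eq[of i] by (simp add: \<kappa>_def inner_diff_left inner_commute[of v u])

lemma s_v_sq: "i \<in> {1..m} \<Longrightarrow> (s i - v) \<bullet> (s i - v) = (\<kappa> + (s i - v) \<bullet> u)\<^sup>2 + C"
  using v_eq[of i] t_eq[of i, symmetric]
  by (simp add: C_def inner_diff_left inner_diff_right inner_commute[of v "s i"] power2_norm_eq_inner)

lemma V_perp: "x \<in> V \<Longrightarrow> x \<bullet> u = 0"
proof -
  assume x: "x \<in> V"
  have "orthogonal (u /\<^sub>R e) y" if "y \<in> w' ` {1..m - 2}" for y
    using that orthonormal_basisD(1)[OF w', of 0] by (fastforce simp: orthogonal_def split: if_splits)
  then have "orthogonal (u /\<^sub>R e) x"
    using orthogonal_to_span[of x "w' ` {1..m - 2}"] x by (simp add: V_def)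
  then show ?thesis using e_pos by (simp add: orthogonal_def inner_commute)
qed

lemma subspace_V: "subspace V" by (simp add: V_def)

lemma U_eq_insert: "U = span (insert u (w' ` {1..m - 2}))"
proof -
  have "{0..m - 2} = insert 0 {1..m - 2}" by auto
  then have "(\<lambda>i. if i = 0 then u /\<^sub>R e else w' i) ` {0..m - 2} = insert ((1 / e) *\<^sub>R u) (w' ` {1..m - 2})"
    by (auto simp: divide_inverse)
  then show ?thesis
    using orthonormal_basisD(2)[OF w'] span_insert_scaleR[of "1 / e" u] e_pos by simp
qed

lemma U_eq_insert_V: "U = span (insert u V)"
  unfolding V_def span_insert_span by (rule U_eq_insert)

lemma in_U_decomp: "x \<in> U \<longleftrightarrow> (\<exists>b y. y \<in> V \<and> x = b *\<^sub>R u + y)"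
proof -
  have "x \<in> U \<longleftrightarrow> (\<exists>b. x - b *\<^sub>R u \<in> V)"
    unfolding U_eq_insert_V span_insert by (simp add: span_eq_iff[THEN iffD2, OF subspace_V])
  also have "\<dots> \<longleftrightarrow> (\<exists>b y. y \<in> V \<and> x = b *\<^sub>R u + y)"
    by (metis add.commute diff_add_cancel add_diff_cancel_left')
  finally show ?thesis .
qed

section \<open>Reduction of the system to one quadratic equation\<close>

text \<open>The assumption cancels the squares in x, and the terms
  \<open>b * ((x - v) \<bullet> u)\<close> cancel as well, so the equation becomes linear in x. It
  is stated for arbitrary x because it serves the given satellites and all of
  \<open>Q_sat\<close>.\<close>

lemma satellite_equation_iff:
  assumes "(x - v) \<bullet> (x - v) = (\<kappa> + (x - v) \<bullet> u)\<^sup>2 + C"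
  shows "(norm (x - (v + b *\<^sub>R u + y)))\<^sup>2 = (\<kappa> + (x - v) \<bullet> u - b)\<^sup>2 \<longleftrightarrow>
    2 * ((x - v) \<bullet> y) = C + (y + b *\<^sub>R u) \<bullet> (y + b *\<^sub>R u) + 2 * b * \<kappa> - b\<^sup>2"
proof -
  define r where "r = x - v"
  define Y where "Y = (y + b *\<^sub>R u) \<bullet> (y + b *\<^sub>R u)"
  have 1: "x - (v + b *\<^sub>R u + y) = r - (y + b *\<^sub>R u)" by (simp add: r_def)
  have 2: "r \<bullet> r = (\<kappa> + r \<bullet> u)\<^sup>2 + C" using assms by (simp add: r_def)
  have 3: "(r - (y + b *\<^sub>R u)) \<bullet> (r - (y + b *\<^sub>R u)) = r \<bullet> r - 2 * (r \<bullet> y) - 2 * b * (r \<bullet> u) + Y"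
    unfolding Y_def
    by (simp add: inner_diff_left inner_diff_right inner_add_left inner_add_right inner_commute)
  show ?thesis
    unfolding r_def[symmetric] power2_norm_eq_inner 1 3 2 Y_def[symmetric]
    by (simp add: power2_eq_square algebra_simps) argo
qed

lemma sol_poly_eq:
  assumes "y \<in> U\<^sup>\<bottom>"
  shows "C + (y + b *\<^sub>R u) \<bullet> (y + b *\<^sub>R u) + 2 * b * \<kappa> - b\<^sup>2 = y \<bullet> y + sol_poly b"
  using orth_U[OF u_in_U assms]
  by (simp add: sol_poly_def inner_add_left inner_add_right inner_commute u_u power2_eq_square algebra_simps)

text \<open>With \<open>y = x - v - b u\<close>, the \<open>i\<close>-th equation reads \<open>2 \<langle>s\<^sub>i - v, y\<rangle> = N\<close> with \<open>N\<close> independent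
  of \<open>i\<close>; hence all equations together force \<open>y \<in> U\<^sup>\<bottom>\<close> and \<open>N = 0\<close>.\<close>

lemma solution_set_iff:
  "(b, x) \<in> solution_set m s t \<longleftrightarrow>
    x - v - b *\<^sub>R u \<in> U\<^sup>\<bottom> \<and> (x - v - b *\<^sub>R u) \<bullet> (x - v - b *\<^sub>R u) + sol_poly b = 0"
proof -
  define y where "y = x - v - b *\<^sub>R u"
  define N where "N = C + (y + b *\<^sub>R u) \<bullet> (y + b *\<^sub>R u) + 2 * b * \<kappa> - b\<^sup>2"
  have "x = v + b *\<^sub>R u + y" by (simp add: y_def)
  then have eqn: "(norm (s i - x))\<^sup>2 = (t i - b)\<^sup>2 \<longleftrightarrow> 2 * ((s i - v) \<bullet> y) = N" if "i \<in> {1..m}" for i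
    using satellite_equation_iff[OF s_v_sq[OF that], of b y] by (simp add: t_eq[OF that] N_def)
  have "(\<forall>i\<in>{1..m}. 2 * ((s i - v) \<bullet> y) = N) \<longleftrightarrow> y \<in> U\<^sup>\<bottom> \<and> y \<bullet> y + sol_poly b = 0"
  proof
    assume all: "\<forall>i\<in>{1..m}. 2 * ((s i - v) \<bullet> y) = N"
    have diff: "orthogonal y (s i - s 1)" if "i \<in> {2..m}" for i
    proof -
      have "2 * ((s i - v) \<bullet> y) = 2 * ((s 1 - v) \<bullet> y)" using all that by auto
      then show ?thesis by (simp add: orthogonal_def inner_diff_left inner_diff_right inner_commute[of y])
    qed
    have "orthogonal y z" if "z \<in> U" for z
      by (rule orthogonal_to_span[OF that[unfolded U_def]]) (use diff in blast)
    then have y: "y \<in> U\<^sup>\<bottom>" by (simp add: orthogonal_comp_def orthogonal_commute)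
    then have "N = 0" using all m1 orth_U[OF s_v_in_U, of 1 y] by auto
    then show "y \<in> U\<^sup>\<bottom> \<and> y \<bullet> y + sol_poly b = 0"
      using y sol_poly_eq[OF y, of b] by (simp add: N_def)
  next
    assume y: "y \<in> U\<^sup>\<bottom> \<and> y \<bullet> y + sol_poly b = 0"
    then have "N = 0" using sol_poly_eq[of y b] by (simp add: N_def)
    then show "\<forall>i\<in>{1..m}. 2 * ((s i - v) \<bullet> y) = N" using y orth_U[OF s_v_in_U] by auto
  qed
  then show ?thesis unfolding y_def[symmetric] solution_set_def using eqn by auto
qed

lemma Q_sol_eq: "Q_sol m s t = {v + b *\<^sub>R u + x | b x. x \<in> U\<^sup>\<bottom> \<and> x \<bullet> x + sol_poly b = 0}"
proof (intro set_eqI iffI)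
  fix x assume "x \<in> Q_sol m s t"
  then obtain b where "(b, x) \<in> solution_set m s t" by (auto simp: Q_sol_def)
  moreover have "x = v + b *\<^sub>R u + (x - v - b *\<^sub>R u)" by simp
  ultimately show "x \<in> {v + b *\<^sub>R u + x | b x. x \<in> U\<^sup>\<bottom> \<and> x \<bullet> x + sol_poly b = 0}"
    unfolding solution_set_iff by blast
next
  fix x assume "x \<in> {v + b *\<^sub>R u + x | b x. x \<in> U\<^sup>\<bottom> \<and> x \<bullet> x + sol_poly b = 0}"
  then obtain b y where "x = v + b *\<^sub>R u + y" "y \<in> U\<^sup>\<bottom>" "y \<bullet> y + sol_poly b = 0" by blast
  then have "(b, x) \<in> solution_set m s t" by (simp add: solution_set_iff)
  then show "x \<in> Q_sol m s t" by (auto simp: Q_sol_def)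
qed

lemma sat_poly_iff:
  assumes "x \<in> V"
  shows "(b *\<^sub>R u + x) \<bullet> (b *\<^sub>R u + x) = (\<kappa> + (b *\<^sub>R u + x) \<bullet> u)\<^sup>2 + C \<longleftrightarrow> x \<bullet> x + sat_poly b = 0"
proof -
  have "(b *\<^sub>R u + x) \<bullet> (b *\<^sub>R u + x) = e\<^sup>2 * b\<^sup>2 + x \<bullet> x" "(b *\<^sub>R u + x) \<bullet> u = e\<^sup>2 * b"
    using V_perp[OF assms] by (auto simp: inner_add_left inner_add_right inner_commute u_u power2_eq_square)
  then show ?thesis unfolding sat_poly_def by (simp only:) argo
qed

lemma satellite_decomp:
  assumes "i \<in> {1..m}"
  obtains b x where "s i = v + b *\<^sub>R u + x" "x \<in> V" "x \<bullet> x + sat_poly b = 0"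
proof -
  obtain b x where bx: "s i - v = b *\<^sub>R u + x" "x \<in> V"
    using s_v_in_U[OF assms] in_U_decomp by blast
  then have "x \<bullet> x + sat_poly b = 0" using s_v_sq[OF assms] sat_poly_iff[of x b] by simp
  moreover have "s i = v + b *\<^sub>R u + x" using bx(1) by (simp add: algebra_simps)
  ultimately show thesis using that bx by blast
qed

section \<open>Completing squares and excluding degenerate quadrics\<close>

lemma sol_poly_central: "e \<noteq> 1 \<Longrightarrow> sol_poly b = (e\<^sup>2 - 1) * (b + \<mu>)\<^sup>2 - \<rho>"
proof -
  assume "e \<noteq> 1"
  then have nz: "e\<^sup>2 - 1 \<noteq> 0" using e_pos by (simp add: power2_eq_1_iff)
  then have "\<kappa> = \<mu> * (e\<^sup>2 - 1)" "\<rho> = \<mu> * \<kappa> - C" by (simp_all add: \<mu>_def \<rho>_def power2_eq_square)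
  then show ?thesis unfolding sol_poly_def by algebra
qed

lemma sat_poly_central: "e \<noteq> 1 \<Longrightarrow> sat_poly b = e\<^sup>2 * (1 - e\<^sup>2) * (b + \<mu>)\<^sup>2 + \<rho>"
proof -
  assume "e \<noteq> 1"
  then have nz: "e\<^sup>2 - 1 \<noteq> 0" using e_pos by (simp add: power2_eq_1_iff)
  then have "\<kappa> = \<mu> * (e\<^sup>2 - 1)" "\<rho> = \<mu> * \<kappa> - C" by (simp_all add: \<mu>_def \<rho>_def power2_eq_square)
  then show ?thesis unfolding sat_poly_def by algebra
qed

text \<open>For m = 2, u is a multiple of \<open>s 2 - s 1\<close>, whence
  \<open>\<bar>t 1 - t 2\<bar> = e * norm (s 1 - s 2)\<close>; the nondegeneracy hypothesis forbids
  e = 1 there.\<close>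

lemma e_eq_1_imp_m: "e = 1 \<Longrightarrow> 2 < m"
proof (rule ccontr)
  assume e: "e = 1" and "\<not> 2 < m"
  then have m: "m = 2" using m2 by simp
  then have "U = span {s 2 - s 1}" unfolding U_def by (intro arg_cong[of _ _ span]) auto
  then obtain a where a: "u = a *\<^sub>R (s 2 - s 1)" using u_in_U by (auto simp: span_singleton)
  have "t 2 - t 1 = (s 2 - s 1) \<bullet> u" using u_eq[of 1] u_eq[of 2] m by (simp add: inner_diff_left)
  also have "\<dots> = a * (norm (s 2 - s 1))\<^sup>2" by (simp add: a power2_norm_eq_inner)
  finally have "\<bar>t 2 - t 1\<bar> = \<bar>a\<bar> * norm (s 2 - s 1) * norm (s 2 - s 1)"
    by (simp add: abs_mult power2_eq_square)
  also have "\<bar>a\<bar> * norm (s 2 - s 1) = 1" using e e_def a by (metis norm_scaleR)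
  finally have "\<bar>t 1 - t 2\<bar> = norm (s 1 - s 2)" by (simp add: abs_minus_commute norm_minus_commute)
  then show False using nondegenerate m by simp
qed

lemma solutionE:
  assumes "p \<in> solution_set m s t"
  obtains y where "y \<in> U\<^sup>\<bottom>" "y \<bullet> y + sol_poly (fst p) = 0" "snd p = v + fst p *\<^sub>R u + y"
proof -
  have "(fst p, snd p) \<in> solution_set m s t" using assms by simp
  then show thesis unfolding solution_set_iff by (intro that[of "snd p - v - fst p *\<^sub>R u"]) auto
qed

text \<open>Otherwise the equation of one quadric is a sum of nonnegative terms. For
  \<open>e < 1\<close> this collapses all satellites to \<open>v - \<mu> *\<^sub>R u\<close> and
  makes the \<open>t i\<close> equal; for \<open>e > 1\<close> it leaves at most one
  solution.\<close>

lemma central_nondegenerate: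
  assumes e: "e \<noteq> 1"
  shows "0 < \<rho> / (e\<^sup>2 - 1)"
proof (cases "e < 1")
  case True
  then have lt: "e\<^sup>2 - 1 < 0" using e_pos by (simp add: abs_square_less_1)
  have "\<rho> < 0"
  proof (rule ccontr)
    assume "\<not> \<rho> < 0"
    have "s i = v - \<mu> *\<^sub>R u" if i: "i \<in> {1..m}" for i
    proof -
      obtain b x where bx: "s i = v + b *\<^sub>R u + x" "x \<bullet> x + sat_poly b = 0"
        using satellite_decomp[OF i] by blast
      have "0 \<le> e\<^sup>2 * (1 - e\<^sup>2) * (b + \<mu>)\<^sup>2" using lt by simp
      then have "x \<bullet> x = 0" "e\<^sup>2 * (1 - e\<^sup>2) * (b + \<mu>)\<^sup>2 = 0"
        using bx(2) \<open>\<not> \<rho> < 0\<close> inner_ge_zero[of x] sat_poly_central[OF e, of b] by linarith+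
      then have "x = 0" "b = - \<mu>" using e_pos lt by (auto simp: add_eq_0_iff2)
      then show ?thesis using bx by simp
    qed
    then have "t i = (v - \<mu> *\<^sub>R u) \<bullet> u - \<alpha>" if "i \<in> {1..m}" for i
      using u_eq[OF that] that by auto
    then show False using t_not_all_equal by auto
  qed
  then show ?thesis using lt by (simp add: divide_neg_neg)
next
  case False
  then have gt: "e\<^sup>2 - 1 > 0" using e by (simp add: one_less_power)
  have "\<rho> > 0"
  proof (rule ccontr)
    assume "\<not> \<rho> > 0"
    have "p = (- \<mu>, v - \<mu> *\<^sub>R u)" if p: "p \<in> solution_set m s t" for p
    proof -
      obtain y where y: "y \<bullet> y + sol_poly (fst p) = 0" "snd p = v + fst p *\<^sub>R u + y"
        using solutionE[OF p] by blast
      have "0 \<le> (e\<^sup>2 - 1) * (fst p + \<mu>)\<^sup>2" using gt by simp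
      then have "y \<bullet> y = 0" "(e\<^sup>2 - 1) * (fst p + \<mu>)\<^sup>2 = 0"
        using y(1) \<open>\<not> \<rho> > 0\<close> inner_ge_zero[of y] sol_poly_central[OF e, of "fst p"] by linarith+
      then have "y = 0" "fst p = - \<mu>" using gt by (auto simp: add_eq_0_iff2)
      then show ?thesis using y(2) by (simp add: prod_eq_iff)
    qed
    then show False using two_solutions by metis
  qed
  then show ?thesis using gt by simp
qed

lemma parabolic_polys:
  assumes "e = 1"
  shows "sol_poly b = 2 * \<kappa> * b + C" "sat_poly b = - \<kappa>\<^sup>2 - 2 * \<kappa> * b - C"
  unfolding sol_poly_def sat_poly_def by (simp_all add: assms power2_eq_square algebra_simps)

text \<open>If \<kappa> = 0, the existence of a solution gives \<open>C \<le> 0\<close>, while each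
  satellite has squared distance C from the line through v in direction u. All satellites then lie
  on this line, against general position with m > 2.\<close>

lemma parabolic_nondegenerate:
  assumes e: "e = 1"
  shows "\<kappa> \<noteq> 0"
proof
  assume \<kappa>: "\<kappa> = 0"
  obtain p where p: "p \<in> solution_set m s t" using two_solutions by blast
  obtain y :: 'a where "y \<bullet> y + sol_poly (fst p) = 0" using solutionE[OF p] by blast
  then have "y \<bullet> y + C = 0" by (simp add: parabolic_polys[OF e] \<kappa>)
  then have C: "C \<le> 0" using inner_ge_zero[of y] by linarith
  have "s i - v \<in> span {u}" if i: "i \<in> {1..m}" for i
  proof -
    obtain b x where bx: "s i = v + b *\<^sub>R u + x" "x \<bullet> x + sat_poly b = 0"
      using satellite_decomp[OF i] by blast
    then have "x \<bullet> x \<le> 0" using C by (simp add: parabolic_polys[OF e] \<kappa>)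
    then have "x = 0" using inner_ge_zero[of x] by (metis antisym inner_eq_zero_iff)
    then show ?thesis using bx by (simp add: span_base span_scale)
  qed
  then have "s i - s 1 \<in> span {u}" if "i \<in> {2..m}" for i
    using span_diff[of "s i - v" "{u}" "s 1 - v"] that m1 by simp
  then have "U \<subseteq> span {u}" unfolding U_def by (intro span_minimal) auto
  then have "dim U \<le> dim {u}" by (metis dim_span dim_subset)
  also have "\<dots> \<le> 1" using dim_le_card[of "{u}" "{u}"] by (simp add: span_superset)
  finally show False
    using e_eq_1_imp_m[OF e] general_position_imp(3)[OF general_position m1] U_def by simp
qed

text \<open>For k = 0 the component in \<open>U\<^sup>\<bottom>\<close> vanishes and b solves a
  linear equation, so there would be only one solution.\<close>

lemma parabolic_k:
  assumes e: "e = 1"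
  shows "1 \<le> k"
proof (rule ccontr)
  assume "\<not> 1 \<le> k"
  then have "U\<^sup>\<bottom> = {0}" using orthonormal_basisD(2)[OF w] by simp
  have "p = (- C / (2 * \<kappa>), v + (- C / (2 * \<kappa>)) *\<^sub>R u)" if p: "p \<in> solution_set m s t" for p
  proof -
    obtain y where y: "y \<in> U\<^sup>\<bottom>" "y \<bullet> y + sol_poly (fst p) = 0" "snd p = v + fst p *\<^sub>R u + y"
      using solutionE[OF p] by blast
    then have "y = 0" using \<open>U\<^sup>\<bottom> = {0}\<close> by simp
    then have "2 * \<kappa> * fst p = - C" using y(2) by (simp add: parabolic_polys[OF e])
    then have "fst p = - C / (2 * \<kappa>)" using parabolic_nondegenerate[OF e] by (simp add: field_simps)
    then show ?thesis using y(3) \<open>y = 0\<close> by (metis add.right_neutral prod.collapse)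
  qed
  then show False using two_solutions by metis
qed

section \<open>The explicit presentations and the satellite set\<close>

text \<open>The squared distance from the common centre to the vertices of the satellite quadric;
  those of the solution quadric are at distance \<open>e * sqrt R\<close>.\<close>

definition "R = \<rho> / (e\<^sup>2 - 1)"

text \<open>The axes remain a parameter because the convention for two points fixes everything
  else.\<close>

definition sol_quadric :: "(nat \<Rightarrow> 'a) \<Rightarrow> 'a focal_quadric" where
  "sol_quadric q = (if e = 1 then Paraboloid (v + lam1 *\<^sub>R u) q (- \<kappa>)
     else (if e > 1 then Spheroid else Hyperboloid) (v - \<mu> *\<^sub>R u) q (e * sqrt R) (sqrt \<bar>\<rho>\<bar>))"

definition sat_quadric :: "(nat \<Rightarrow> 'a) \<Rightarrow> 'a focal_quadric" where
  "sat_quadric q = (if e = 1 then Paraboloid (v + lam2 *\<^sub>R u) q \<kappa>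
     else (if e > 1 then Hyperboloid else Spheroid) (v - \<mu> *\<^sub>R u) q (sqrt R) (sqrt \<bar>\<rho>\<bar>))"

definition "sol_axes j = (if j = 0 then u /\<^sub>R e else w j)"
definition "sat_axes j = (if j = 0 then u /\<^sub>R e else w' j)"

text \<open>The coordinate along u, measured from v, of the origin of the presentation.\<close>

definition "\<tau>_sol = (if e = 1 then lam1 else - \<mu>)"
definition "\<tau>_sat = (if e = 1 then lam2 else - \<mu>)"

lemma \<rho>_eq: "e \<noteq> 1 \<Longrightarrow> \<rho> = R * (e\<^sup>2 - 1)" and R_pos: "e \<noteq> 1 \<Longrightarrow> 0 < R"
proof -
  assume "e \<noteq> 1"
  then have "e\<^sup>2 \<noteq> 1" using e_pos by (simp add: power2_eq_1_iff)
  then show "\<rho> = R * (e\<^sup>2 - 1)" by (simp add: R_def)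
  show "0 < R" unfolding R_def by (rule central_nondegenerate) fact
qed

lemma sol_quadric:
  "admissible (sol_quadric q)" "eccentricity (sol_quadric q) = 1 / e" "origin (sol_quadric q) = v + \<tau>_sol *\<^sub>R u"
  "axes (sol_quadric q) = q"
  "sol_poly b = e\<^sup>2 * (1 - (1 / e)\<^sup>2) * (b - \<tau>_sol)\<^sup>2 - 2 * linear_constant (sol_quadric q) * e * (b - \<tau>_sol)
    - level_constant (sol_quadric q)"
proof -
  have "admissible (sol_quadric q) \<and> eccentricity (sol_quadric q) = 1 / e \<and>
      origin (sol_quadric q) = v + \<tau>_sol *\<^sub>R u \<and> axes (sol_quadric q) = q \<and>
      sol_poly b = e\<^sup>2 * (1 - (1 / e)\<^sup>2) * (b - \<tau>_sol)\<^sup>2 - 2 * linear_constant (sol_quadric q) * e * (b - \<tau>_sol)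
        - level_constant (sol_quadric q)"
  proof (cases "e = 1")
    case True
    have F: "sol_quadric q = Paraboloid (v + lam1 *\<^sub>R u) q (- \<kappa>)" "\<tau>_sol = lam1"
      unfolding sol_quadric_def \<tau>_sol_def by (simp_all add: True)
    have "2 * \<kappa> * lam1 = - C" using parabolic_nondegenerate[OF True] by (simp add: lam1_def)
    then show ?thesis
      unfolding F parabolic_polys[OF True]
      using parabolic_nondegenerate[OF True] True by (simp add: algebra_simps)
  next
    case False
    have "e\<^sup>2 * (1 - (1 / e)\<^sup>2) = e\<^sup>2 - 1" using e_pos by (simp add: power_divide field_simps)
    then show ?thesis
      using False central_quadric[OF e_pos False R_pos[OF False], of "v - \<mu> *\<^sub>R u" q]
      by (simp add: sol_quadric_def \<tau>_sol_def sol_poly_central \<rho>_eq)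
  qed
  then show "admissible (sol_quadric q)" "eccentricity (sol_quadric q) = 1 / e" "origin (sol_quadric q) = v + \<tau>_sol *\<^sub>R u"
    "axes (sol_quadric q) = q"
    "sol_poly b = e\<^sup>2 * (1 - (1 / e)\<^sup>2) * (b - \<tau>_sol)\<^sup>2 - 2 * linear_constant (sol_quadric q) * e * (b - \<tau>_sol)
      - level_constant (sol_quadric q)" by auto
qed

lemma sat_quadric:
  "admissible (sat_quadric q)" "eccentricity (sat_quadric q) = e" "origin (sat_quadric q) = v + \<tau>_sat *\<^sub>R u"
  "axes (sat_quadric q) = q"
  "sat_poly b = e\<^sup>2 * (1 - e\<^sup>2) * (b - \<tau>_sat)\<^sup>2 - 2 * linear_constant (sat_quadric q) * e * (b - \<tau>_sat)
    - level_constant (sat_quadric q)"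
proof -
  have "admissible (sat_quadric q) \<and> eccentricity (sat_quadric q) = e \<and>
      origin (sat_quadric q) = v + \<tau>_sat *\<^sub>R u \<and> axes (sat_quadric q) = q \<and>
      sat_poly b = e\<^sup>2 * (1 - e\<^sup>2) * (b - \<tau>_sat)\<^sup>2 - 2 * linear_constant (sat_quadric q) * e * (b - \<tau>_sat)
        - level_constant (sat_quadric q)"
  proof (cases "e = 1")
    case True
    have F: "sat_quadric q = Paraboloid (v + lam2 *\<^sub>R u) q \<kappa>" "\<tau>_sat = lam2"
      unfolding sat_quadric_def \<tau>_sat_def by (simp_all add: True)
    have "2 * \<kappa> * lam2 = - C - \<kappa>\<^sup>2"
      using parabolic_nondegenerate[OF True] by (simp add: lam1_def lam2_def right_diff_distrib power2_eq_square)
    then show ?thesis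
      unfolding F parabolic_polys[OF True]
      using parabolic_nondegenerate[OF True] True by (simp add: algebra_simps)
  next
    case False
    then show ?thesis
      using conjugate_central_quadric[OF e_pos False R_pos[OF False], of "v - \<mu> *\<^sub>R u" q]
      by (simp add: sat_quadric_def \<tau>_sat_def sat_poly_central \<rho>_eq)
  qed
  then show "admissible (sat_quadric q)" "eccentricity (sat_quadric q) = e" "origin (sat_quadric q) = v + \<tau>_sat *\<^sub>R u"
    "axes (sat_quadric q) = q"
    "sat_poly b = e\<^sup>2 * (1 - e\<^sup>2) * (b - \<tau>_sat)\<^sup>2 - 2 * linear_constant (sat_quadric q) * e * (b - \<tau>_sat)
      - level_constant (sat_quadric q)" by auto
qed

text \<open>For e = 1 the focal shifts along u are \<open>\<kappa> / 2\<close> and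
  \<open>- \<kappa> / 2\<close>, and lam1 and lam2 differ by exactly this. Otherwise both quadrics
  have the same centre, and \<open>sqrt R\<close> and \<open>e * sqrt R\<close> change
  roles.\<close>

lemma foci_vertices:
  assumes "q 0 = q' 0" "q 0 = u /\<^sub>R e"
  shows "foci (sat_quadric q) = vertices (sol_quadric q')" "foci (sol_quadric q) = vertices (sat_quadric q')"
proof -
  have "foci (sat_quadric q) = vertices (sol_quadric q') \<and> foci (sol_quadric q) = vertices (sat_quadric q')"
  proof (cases "e = 1")
    case True
    have F: "sol_quadric q = Paraboloid (v + lam1 *\<^sub>R u) q (- \<kappa>)"
        "sat_quadric q = Paraboloid (v + lam2 *\<^sub>R u) q \<kappa>" for q
      unfolding sol_quadric_def sat_quadric_def by (simp_all add: True)
    have "v + lam2 *\<^sub>R u + (\<kappa> / 2) *\<^sub>R u = v + lam1 *\<^sub>R u"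
      "v + lam1 *\<^sub>R u + (- \<kappa> / 2) *\<^sub>R u = v + lam2 *\<^sub>R u"
      by (simp_all add: lam2_def scaleR_left_diff_distrib)
    then show ?thesis unfolding F using assms True by simp
  next
    case False
    then show ?thesis
      using central_quadric(7,8)[OF e_pos False R_pos[OF False], of "v - \<mu> *\<^sub>R u"]
        conjugate_central_quadric(7,8)[OF e_pos False R_pos[OF False], of "v - \<mu> *\<^sub>R u"] assms
      by (simp add: sat_quadric_def sol_quadric_def \<rho>_eq)
  qed
  then show "foci (sat_quadric q) = vertices (sol_quadric q')" "foci (sol_quadric q) = vertices (sat_quadric q')"
    by auto
qed

lemma sol_axes_basis: "orthonormal_basis {0..k} sol_axes (span (insert u (U\<^sup>\<bottom>)))"
  unfolding orthonormal_basis_def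
proof (intro conjI ballI)
  have uw: "u \<bullet> w j = 0" "w j \<bullet> u = 0" if "j \<in> {1..k}" for j using u_w[OF that] by (auto simp: inner_commute)
  fix i j assume "i \<in> {0..k}" "j \<in> {0..k}"
  then show "sol_axes i \<bullet> sol_axes j = (if i = j then 1 else 0)"
    using uw orthonormal_basisD(1)[OF w, of i j] e_pos
    by (auto simp: sol_axes_def u_u power2_eq_square field_simps)
next
  have "{0..k} = insert 0 {1..k}" by auto
  then have "sol_axes ` {0..k} = insert ((1 / e) *\<^sub>R u) (w ` {1..k})"
    by (auto simp: sol_axes_def divide_inverse)
  then have "span (sol_axes ` {0..k}) = span (insert u (w ` {1..k}))"
    using span_insert_scaleR[of "1 / e" u] e_pos by simp
  also have "\<dots> = span (insert u (U\<^sup>\<bottom>))"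
    unfolding orthonormal_basisD(2)[OF w, symmetric] span_insert_span ..
  finally show "span (sol_axes ` {0..k}) = span (insert u (U\<^sup>\<bottom>))" .
qed

lemma sat_axes_basis: "orthonormal_basis {0..m - 2} sat_axes U"
  using w' by (simp add: sat_axes_def[abs_def])

lemma Q_sol_focal_form: "Q_sol m s t = focal_form (span (insert u (U\<^sup>\<bottom>))) (sol_quadric sol_axes)"
proof -
  have axis: "sol_axes 0 = u /\<^sub>R norm u" unfolding sol_axes_def by (simp add: e_def)
  show ?thesis
    unfolding Q_sol_eq sol_quadric(2-4) axis
  proof (rule quadric_eq_focal_set)
    show "x \<bullet> u = 0" if "x \<in> U\<^sup>\<bottom>" for x using orth_U[OF u_in_U that] by (simp add: inner_commute)
    show "sol_poly b = (norm u)\<^sup>2 * (1 - (1 / e)\<^sup>2) * (b - \<tau>_sol)\<^sup>2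
        - 2 * linear_constant (sol_quadric sol_axes) * norm u * (b - \<tau>_sol)
        - level_constant (sol_quadric sol_axes)" for b
      unfolding e_def[symmetric] by (rule sol_quadric(5))
  qed (simp_all add: subspace_orthogonal_comp u_nz)
qed

lemma presents_sol: "presents k (Q_sol m s t) (sol_quadric sol_axes)"
  and affine_hull_Q_sol: "affine hull Q_sol m s t = (+) v ` span (insert u (U\<^sup>\<bottom>))"
proof -
  \<comment> \<open>A paraboloid spans its space only in dimension at least two; eccentricity 1
    means e = 1, where \<open>parabolic_k\<close> provides this.\<close>
  have d: "eccentricity (sol_quadric sol_axes) \<noteq> 1 \<or> 1 \<le> k"
    using parabolic_k e_pos by (auto simp: sol_quadric)
  have axes: "orthonormal_basis {0..k} (axes (sol_quadric sol_axes)) (span (insert u (U\<^sup>\<bottom>)))"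
    using sol_axes_basis by (simp add: sol_quadric)
  note P = presents_focal_form_intro[OF sol_quadric(1) axes Q_sol_focal_form d]
  show "presents k (Q_sol m s t) (sol_quadric sol_axes)" by (rule P(1))
  have "(+) (v + \<tau>_sol *\<^sub>R u) ` span (insert u (U\<^sup>\<bottom>)) = (+) v ` span (insert u (U\<^sup>\<bottom>))"
    by (intro translation_subspace_eq) (auto intro: span_scale span_base)
  then show "affine hull Q_sol m s t = (+) v ` span (insert u (U\<^sup>\<bottom>))"
    using P(2) by (simp add: sol_quadric)
qed

text \<open>On \<open>Q\<^sub>s\<^sub>o\<^sub>l\<close> the satellite equation is affine in \<open>z\<close>; since it holds on all of \<open>Q\<^sub>s\<^sub>o\<^sub>l\<close>, it holds on the
  affine hull of \<open>Q\<^sub>s\<^sub>o\<^sub>l\<close>, and comparing coefficients determines the satellite.\<close>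

lemma satellite_set_iff:
  "(\<tau>, x) \<in> satellite_set (solution_set m s t) \<longleftrightarrow>
    x - v \<in> U \<and> \<tau> = \<kappa> + (x - v) \<bullet> u \<and> (x - v) \<bullet> (x - v) = (\<kappa> + (x - v) \<bullet> u)\<^sup>2 + C"
proof
  assume sat: "(\<tau>, x) \<in> satellite_set (solution_set m s t)"
  define d where "d = x - v"
  \<comment> \<open>Chosen so that n becomes the normal of a hyperplane containing all solutions:
    the part of n along u absorbs the term \<open>(\<kappa> - \<tau>) * b\<close> that remains when
    the equation of the solution is subtracted.\<close>
  define a where "a = (\<kappa> - \<tau>) / e\<^sup>2"
  have a: "a * e\<^sup>2 = \<kappa> - \<tau>" using e_pos by (simp add: a_def)
  define n where "n = d + a *\<^sub>R u"
  define K where "K = (d \<bullet> d - C - \<tau>\<^sup>2) / 2"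
  have "n \<bullet> z = K + n \<bullet> v" if "z \<in> Q_sol m s t" for z
  proof -
    obtain b y where z: "z = v + b *\<^sub>R u + y" and y: "y \<in> U\<^sup>\<bottom>" "y \<bullet> y + sol_poly b = 0"
      using \<open>z \<in> Q_sol m s t\<close> unfolding Q_sol_eq by blast
    have "(b, z) \<in> solution_set m s t" using y by (simp add: solution_set_iff z)
    then have "(x - z) \<bullet> (x - z) = (\<tau> - b)\<^sup>2" using sat by (auto simp: satellite_set_def power2_norm_eq_inner)
    moreover have "x - z = d - (b *\<^sub>R u + y)" by (simp add: z d_def)
    moreover have uy: "u \<bullet> y = 0" "y \<bullet> u = 0" using orth_U[OF u_in_U y(1)] by (auto simp: inner_commute)
    then have "(d - (b *\<^sub>R u + y)) \<bullet> (d - (b *\<^sub>R u + y))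
        = d \<bullet> d - 2 * b * (d \<bullet> u) - 2 * (d \<bullet> y) + e\<^sup>2 * b\<^sup>2 + y \<bullet> y"
      by (simp add: inner_diff_left inner_diff_right inner_add_left inner_add_right inner_commute[of u d] inner_commute[of y d]
          u_u power2_eq_square algebra_simps)
    ultimately have *: "d \<bullet> d - 2 * b * (d \<bullet> u) - 2 * (d \<bullet> y) + e\<^sup>2 * b\<^sup>2 + y \<bullet> y = (\<tau> - b)\<^sup>2" by simp
    have "n \<bullet> z - n \<bullet> v = b * (d \<bullet> u) + d \<bullet> y + (a * e\<^sup>2) * b"
      using uy by (simp add: n_def z inner_add_left inner_add_right u_u algebra_simps)
    also have "\<dots> = b * (d \<bullet> u) + d \<bullet> y + (\<kappa> - \<tau>) * b" by (simp only: a)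
    also have "\<dots> = K" using * y(2) by (simp add: K_def sol_poly_def power2_eq_square algebra_simps)
    finally show ?thesis by simp
  qed
  then have "affine hull Q_sol m s t \<subseteq> {z. n \<bullet> z = K + n \<bullet> v}"
    by (intro hull_minimal) (auto simp: affine_hyperplane)
  \<comment> \<open>A linear functional that is constant on a subspace vanishes there. Evaluating at
    0, at u and on \<open>U\<^sup>\<bottom>\<close> yields in turn the norm relation, the value of
    \<tau> and membership in U.\<close>
  then have hyp: "n \<bullet> y = K" if "y \<in> span (insert u (U\<^sup>\<bottom>))" for y
    using that unfolding affine_hull_Q_sol by (force simp: inner_add_right)
  have K: "K = 0" using hyp[of 0] by (simp add: span_0)
  have "n \<bullet> u = 0" using hyp[of u] K by (simp add: span_base)
  then have \<tau>: "\<tau> = \<kappa> + d \<bullet> u" using a by (simp add: n_def inner_add_left u_u)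
  have "y \<bullet> d = 0" if "y \<in> U\<^sup>\<bottom>" for y
  proof -
    have "n \<bullet> y = d \<bullet> y" using orth_U[OF u_in_U that] by (simp add: n_def inner_add_left)
    then show ?thesis using hyp[of y] that K by (simp add: span_base inner_commute[of y d])
  qed
  then have "d \<in> U\<^sup>\<bottom>\<^sup>\<bottom>" by (simp add: orthogonal_comp_def orthogonal_def)
  then have "d \<in> U" using orthogonal_comp_self[OF subspace_U] by simp
  moreover have "d \<bullet> d = (\<kappa> + d \<bullet> u)\<^sup>2 + C" using K \<tau> by (simp add: K_def)
  ultimately show "x - v \<in> U \<and> \<tau> = \<kappa> + (x - v) \<bullet> u \<and> (x - v) \<bullet> (x - v) = (\<kappa> + (x - v) \<bullet> u)\<^sup>2 + C"
    using \<tau> by (simp add: d_def)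
next
  assume x: "x - v \<in> U \<and> \<tau> = \<kappa> + (x - v) \<bullet> u \<and> (x - v) \<bullet> (x - v) = (\<kappa> + (x - v) \<bullet> u)\<^sup>2 + C"
  have "(norm (x - z))\<^sup>2 = (\<tau> - b)\<^sup>2" if z: "(b, z) \<in> solution_set m s t" for b z
  proof -
    obtain y where y: "y \<in> U\<^sup>\<bottom>" "y \<bullet> y + sol_poly b = 0" "z = v + b *\<^sub>R u + y"
      using solutionE[OF z] by auto
    then show ?thesis
      using satellite_equation_iff[of x b y] x orth_U[of "x - v" y] sol_poly_eq[OF y(1), of b] by simp
  qed
  then show "(\<tau>, x) \<in> satellite_set (solution_set m s t)" by (auto simp: satellite_set_def)
qed

lemma Q_sat_eq: "Q_sat m s t = {v + b *\<^sub>R u + x | b x. x \<in> V \<and> x \<bullet> x + sat_poly b = 0}"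
proof (intro set_eqI iffI)
  fix x assume "x \<in> Q_sat m s t"
  then have x: "x - v \<in> U" "(x - v) \<bullet> (x - v) = (\<kappa> + (x - v) \<bullet> u)\<^sup>2 + C"
    by (auto simp: Q_sat_def satellite_set_iff)
  then obtain b y where y: "y \<in> V" "x - v = b *\<^sub>R u + y" using in_U_decomp by blast
  then have "y \<bullet> y + sat_poly b = 0" using x(2) sat_poly_iff[OF y(1), of b] by simp
  moreover have "x = v + b *\<^sub>R u + y" using y(2) by (simp add: algebra_simps)
  ultimately show "x \<in> {v + b *\<^sub>R u + x | b x. x \<in> V \<and> x \<bullet> x + sat_poly b = 0}" using y(1) by blast
next
  fix x assume "x \<in> {v + b *\<^sub>R u + x | b x. x \<in> V \<and> x \<bullet> x + sat_poly b = 0}"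
  then obtain b y where y: "x = v + b *\<^sub>R u + y" "y \<in> V" "y \<bullet> y + sat_poly b = 0" by blast
  have d: "x - v = b *\<^sub>R u + y" by (simp add: y(1))
  then have "x - v \<in> U" using in_U_decomp y(2) by blast
  moreover have "(x - v) \<bullet> (x - v) = (\<kappa> + (x - v) \<bullet> u)\<^sup>2 + C"
    using sat_poly_iff[OF y(2), of b] y(3) by (simp add: d)
  ultimately show "x \<in> Q_sat m s t" by (auto simp: Q_sat_def satellite_set_iff)
qed

lemma Q_sat_focal_form: "Q_sat m s t = focal_form U (sat_quadric sat_axes)"
proof -
  have axis: "sat_axes 0 = u /\<^sub>R norm u" unfolding sat_axes_def by (simp add: e_def)
  show ?thesis
    unfolding Q_sat_eq sat_quadric(2-4) axis U_eq_insert_V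
  proof (rule quadric_eq_focal_set)
    show "sat_poly b = (norm u)\<^sup>2 * (1 - e\<^sup>2) * (b - \<tau>_sat)\<^sup>2
        - 2 * linear_constant (sat_quadric sat_axes) * norm u * (b - \<tau>_sat)
        - level_constant (sat_quadric sat_axes)" for b
      unfolding e_def[symmetric] by (rule sat_quadric(5))
  qed (simp_all add: subspace_V u_nz V_perp)
qed

lemma presents_sat: "presents (m - 2) (Q_sat m s t) (sat_quadric sat_axes)"
  and affine_hull_Q_sat: "affine hull Q_sat m s t = (+) v ` U"
proof -
  have d: "eccentricity (sat_quadric sat_axes) \<noteq> 1 \<or> 1 \<le> m - 2"
    using e_eq_1_imp_m by (auto simp: sat_quadric)
  have axes: "orthonormal_basis {0..m - 2} (axes (sat_quadric sat_axes)) U"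
    using sat_axes_basis by (simp add: sat_quadric)
  note P = presents_focal_form_intro[OF sat_quadric(1) axes Q_sat_focal_form d]
  show "presents (m - 2) (Q_sat m s t) (sat_quadric sat_axes)" by (rule P(1))
  have "(+) (v + \<tau>_sat *\<^sub>R u) ` U = (+) v ` U"
    using subspace_scale[OF subspace_U u_in_U] by (intro translation_subspace_eq subspace_U) auto
  then show "affine hull Q_sat m s t = (+) v ` U"
    using P(2) by (simp add: sat_quadric)
qed

section \<open>Reduction of arbitrary presentations to the explicit ones\<close>

definition "Sol = {F. presents k (Q_sol m s t) F \<and> (k = 0 \<longrightarrow> (\<exists>q.
  F = (if e > 1 then Spheroid else Hyperboloid) (v - \<mu> *\<^sub>R u) q (e * sqrt (\<rho> / (e\<^sup>2 - 1))) (sqrt \<bar>\<rho>\<bar>)))}"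

definition "Sat = {G. presents (m - 2) (Q_sat m s t) G \<and> (m = 2 \<longrightarrow> (\<exists>q.
  G = (if e > 1 then Hyperboloid else Spheroid) (v - \<mu> *\<^sub>R u) q (sqrt (\<rho> / (e\<^sup>2 - 1))) (sqrt \<bar>\<rho>\<bar>)))}"

text \<open>\<open>parabolic_k\<close> excludes e = 1, so the convention for two points picks a
  branch of \<open>sol_quadric\<close>.\<close>

lemma k_eq_0_shape:
  assumes "k = 0"
  shows "(if e > 1 then Spheroid else Hyperboloid) (v - \<mu> *\<^sub>R u) q (e * sqrt (\<rho> / (e\<^sup>2 - 1))) (sqrt \<bar>\<rho>\<bar>) = sol_quadric q"
proof -
  have "e \<noteq> 1" using parabolic_k assms by auto
  then show ?thesis by (simp add: sol_quadric_def R_def)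
qed

lemma m_eq_2_shape:
  assumes "m = 2"
  shows "(if e > 1 then Hyperboloid else Spheroid) (v - \<mu> *\<^sub>R u) q (sqrt (\<rho> / (e\<^sup>2 - 1))) (sqrt \<bar>\<rho>\<bar>) = sat_quadric q"
proof -
  have "e \<noteq> 1" using e_eq_1_imp_m assms by auto
  then show ?thesis by (simp add: sat_quadric_def R_def)
qed

lemma sol_quadric_in_Sol: "sol_quadric sol_axes \<in> Sol"
  using presents_sol k_eq_0_shape[symmetric] unfolding Sol_def by blast

lemma sat_quadric_in_Sat: "sat_quadric sat_axes \<in> Sat"
  using presents_sat m_eq_2_shape[symmetric] unfolding Sat_def by blast

text \<open>For \<open>k \<ge> 1\<close> this is uniqueness of the normal form; for k = 0 the
  convention provides centre and eccentricity.\<close>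

lemma Sol_invariants:
  assumes "F \<in> Sol"
  shows "eccentricity F = 1 / e" "symmetry_axis F = symmetry_axis (sol_quadric sol_axes)"
    "vertices F = vertices (sol_quadric sol_axes)" "foci F = foci (sol_quadric sol_axes)"
proof -
  have F: "presents k (Q_sol m s t) F" using assms by (simp add: Sol_def)
  have "origin F = origin (sol_quadric sol_axes) \<and> eccentricity F = eccentricity (sol_quadric sol_axes) \<and>
      eccentricity (sol_quadric sol_axes) \<noteq> 1" if k: "k = 0"
  proof -
    obtain q where "F = sol_quadric q" using assms k k_eq_0_shape unfolding Sol_def by auto
    moreover have "e \<noteq> 1" using parabolic_k k by auto
    ultimately show ?thesis using e_pos by (simp add: sol_quadric)
  qed
  note I = presents_invariants[OF F presents_sol this]
  show "eccentricity F = 1 / e" using I(1) by (simp add: sol_quadric)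
  show "symmetry_axis F = symmetry_axis (sol_quadric sol_axes)" "vertices F = vertices (sol_quadric sol_axes)"
    "foci F = foci (sol_quadric sol_axes)" by (simp_all only: I(2-4))
qed

lemma Sat_invariants:
  assumes "G \<in> Sat"
  shows "eccentricity G = e" "symmetry_axis G = symmetry_axis (sat_quadric sat_axes)"
    "vertices G = vertices (sat_quadric sat_axes)" "foci G = foci (sat_quadric sat_axes)"
proof -
  have G: "presents (m - 2) (Q_sat m s t) G" using assms by (simp add: Sat_def)
  have "origin G = origin (sat_quadric sat_axes) \<and> eccentricity G = eccentricity (sat_quadric sat_axes) \<and>
      eccentricity (sat_quadric sat_axes) \<noteq> 1" if "m - 2 = 0"
  proof -
    have m: "m = 2" using that m2 by simp
    obtain q where "G = sat_quadric q" using assms m m_eq_2_shape unfolding Sat_def by auto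
    moreover have "e \<noteq> 1" using e_eq_1_imp_m m by auto
    ultimately show ?thesis by (simp add: sat_quadric)
  qed
  note I = presents_invariants[OF G presents_sat this]
  show "eccentricity G = e" using I(1) by (simp add: sat_quadric)
  show "symmetry_axis G = symmetry_axis (sat_quadric sat_axes)" "vertices G = vertices (sat_quadric sat_axes)"
    "foci G = foci (sat_quadric sat_axes)" by (simp_all only: I(2-4))
qed

lemma line_reparam: "{v + \<tau> *\<^sub>R u + \<xi> *\<^sub>R (u /\<^sub>R e) | \<xi>. True} = {v + c *\<^sub>R u | c. True}"
proof (intro set_eqI iffI; clarify)
  fix \<xi>
  show "\<exists>c. v + \<tau> *\<^sub>R u + \<xi> *\<^sub>R (u /\<^sub>R e) = v + c *\<^sub>R u \<and> True"
    by (rule exI[of _ "\<tau> + \<xi> / e"]) (simp add: scaleR_left_distrib divide_inverse)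
next
  fix c
  show "\<exists>\<xi>. v + c *\<^sub>R u = v + \<tau> *\<^sub>R u + \<xi> *\<^sub>R (u /\<^sub>R e) \<and> True"
  proof (intro exI conjI)
    have "((c - \<tau>) * e) *\<^sub>R (u /\<^sub>R e) = (c - \<tau>) *\<^sub>R u" using e_pos by simp
    then show "v + c *\<^sub>R u = v + \<tau> *\<^sub>R u + ((c - \<tau>) * e) *\<^sub>R (u /\<^sub>R e)"
      by (simp only: scaleR_left_diff_distrib) simp
  qed simp
qed

lemma symmetry_axes:
  "symmetry_axis (sol_quadric sol_axes) = {v + c *\<^sub>R u | c. True}"
  "symmetry_axis (sat_quadric sat_axes) = {v + c *\<^sub>R u | c. True}"
  using line_reparam[of \<tau>_sol] line_reparam[of \<tau>_sat]
  by (simp_all add: symmetry_axis_def sol_quadric sat_quadric sol_axes_def sat_axes_def)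

lemma sol_sat_foci_vertices:
  "foci (sat_quadric sat_axes) = vertices (sol_quadric sol_axes)"
  "foci (sol_quadric sol_axes) = vertices (sat_quadric sat_axes)"
  by (intro foci_vertices; simp add: sol_axes_def sat_axes_def)+

section \<open>Intersection, perpendicularity, two-point quadrics and tangent spaces\<close>

lemma span_insert_U_perp: "x \<in> span (insert u (U\<^sup>\<bottom>)) \<longleftrightarrow> (\<exists>c y. y \<in> U\<^sup>\<bottom> \<and> x = c *\<^sub>R u + y)"
proof -
  have "x \<in> span (insert u (U\<^sup>\<bottom>)) \<longleftrightarrow> (\<exists>c. x - c *\<^sub>R u \<in> U\<^sup>\<bottom>)"
    unfolding span_insert by (simp add: span_eq_iff[THEN iffD2, OF subspace_orthogonal_comp])
  also have "\<dots> \<longleftrightarrow> (\<exists>c y. y \<in> U\<^sup>\<bottom> \<and> x = c *\<^sub>R u + y)"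
    by (metis add.commute diff_add_cancel add_diff_cancel_left')
  finally show ?thesis .
qed

lemma translation_span_insert: "(+) v ` span (insert u (U\<^sup>\<bottom>)) = {v + c *\<^sub>R u + x | c x. x \<in> U\<^sup>\<bottom>}"
  by (auto simp: image_iff Bex_def span_insert_U_perp add.assoc) blast+

lemma span_insert_w: "span (insert u (w ` {1..k})) = span (insert u (U\<^sup>\<bottom>))"
  unfolding orthonormal_basisD(2)[OF w, symmetric] span_insert_span ..

lemma span_Int_U:
  assumes "x \<in> span (insert u (U\<^sup>\<bottom>))" "x \<in> U"
  shows "\<exists>c. x = c *\<^sub>R u"
proof -
  obtain c y where x: "y \<in> U\<^sup>\<bottom>" "x = c *\<^sub>R u + y" using assms(1) span_insert_U_perp by blast
  have "x - c *\<^sub>R u \<in> U" using assms(2) u_in_U subspace_U by (simp add: subspace_diff subspace_scale)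
  then have "y \<in> U" using x(2) by simp
  then have "y \<in> {0}" using x(1) orthogonal_Int_0[OF subspace_U] by blast
  then show ?thesis using x(2) by auto
qed

lemma hulls_Int: "(+) v ` span (insert u (U\<^sup>\<bottom>)) \<inter> (+) v ` U = {v + c *\<^sub>R u | c. True}"
proof (intro set_eqI iffI)
  fix x assume "x \<in> (+) v ` span (insert u (U\<^sup>\<bottom>)) \<inter> (+) v ` U"
  then have "x - v \<in> span (insert u (U\<^sup>\<bottom>))" "x - v \<in> U" by (auto simp: mem_translation_iff)
  then obtain c where "x - v = c *\<^sub>R u" using span_Int_U by blast
  then have "x = v + c *\<^sub>R u" by (simp add: algebra_simps)
  then show "x \<in> {v + c *\<^sub>R u | c. True}" by blast
next
  fix x assume "x \<in> {v + c *\<^sub>R u | c. True}"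
  then show "x \<in> (+) v ` span (insert u (U\<^sup>\<bottom>)) \<inter> (+) v ` U"
    using subspace_scale[OF subspace_U u_in_U] by (auto simp: span_scale span_base)
qed

text \<open>The direction spaces share the line of u. Removing it from the first one leaves
  \<open>U\<^sup>\<bottom>\<close>, which is orthogonal to the whole second one.\<close>

lemma hulls_perpendicular: "perpendicular ((+) v ` span (insert u (U\<^sup>\<bottom>))) ((+) v ` U)"
proof (rule perpendicular_translations[of _ _ v])
  fix x y assume x: "x \<in> span (insert u (U\<^sup>\<bottom>))" and y: "y \<in> U"
    and orth: "\<And>z. z \<in> span (insert u (U\<^sup>\<bottom>)) \<inter> U \<Longrightarrow> x \<bullet> z = 0"
  obtain c x' where x': "x' \<in> U\<^sup>\<bottom>" "x = c *\<^sub>R u + x'" using x span_insert_U_perp by blast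
  have "x \<bullet> u = 0" using orth[of u] u_in_U by (simp add: span_base)
  then have "c = 0"
    using x'(2) orth_U[OF u_in_U x'(1)] u_nz by (simp add: inner_add_left inner_commute[of x' u])
  then show "x \<bullet> y = 0" using x' orth_U[OF y x'(1)] by (simp add: inner_commute)
qed (auto simp: subspace_U subspace_0 span_0)

text \<open>The quadric lies in its own span, which meets the span of the satellites in the axis;
  points on the axis are vertices.\<close>

lemma Q_sol_Int: "Q_sol m s t \<inter> (+) v ` U = vertices (sol_quadric sol_axes)"
proof -
  have "Q_sol m s t \<subseteq> (+) v ` span (insert u (U\<^sup>\<bottom>))"
    unfolding affine_hull_Q_sol[symmetric] by (rule hull_subset)
  then have "Q_sol m s t \<inter> (+) v ` U = Q_sol m s t \<inter> {v + c *\<^sub>R u | c. True}"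
    unfolding hulls_Int[symmetric] by blast
  then show ?thesis using presents_axis_Int[OF presents_sol] symmetry_axes by simp
qed

lemma card_vertices:
  assumes "e \<noteq> 1" "q 0 = u /\<^sub>R e"
  shows "card (vertices (sol_quadric q)) = 2" "card (vertices (sat_quadric q)) = 2"
proof -
  have two: "card {c + a *\<^sub>R q 0, c - a *\<^sub>R q 0} = 2" if "a > 0" for a and c :: 'a
  proof -
    have "c + a *\<^sub>R q 0 \<noteq> c - a *\<^sub>R q 0"
    proof
      assume "c + a *\<^sub>R q 0 = c - a *\<^sub>R q 0"
      then have "a *\<^sub>R q 0 + a *\<^sub>R q 0 = 0" by (metis add_diff_cancel_left' diff_add_cancel diff_diff_eq eq_iff_diff_eq_0 add.assoc)
      then have "(a + a) *\<^sub>R q 0 = 0" by (simp only: scaleR_left_distrib)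
      then show False using that assms e_pos u_nz by simp
    qed
    then show ?thesis by simp
  qed
  show "card (vertices (sol_quadric q)) = 2" "card (vertices (sat_quadric q)) = 2"
    using two[of "e * sqrt R"] two[of "sqrt R"] e_pos R_pos[OF assms(1)] assms(1)
    by (simp_all add: sol_quadric_def sat_quadric_def)
qed

text \<open>For k = 0, U is the whole space, so intersecting with the translate of U loses nothing
  and all points are vertices.\<close>

lemma card_Q_sol:
  assumes "k = 0"
  shows "card (Q_sol m s t) = 2"
proof -
  have "U\<^sup>\<bottom> = {0}" using orthonormal_basisD(2)[OF w] assms by simp
  then have "U = UNIV" using orthogonal_comp_self[OF subspace_U] by (metis orthogonal_comp_null)
  then have "Q_sol m s t = vertices (sol_quadric sol_axes)" using Q_sol_Int by (simp add: surj_plus)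
  moreover have "e \<noteq> 1" using parabolic_k assms by auto
  ultimately show ?thesis using card_vertices(1)[of sol_axes] by (simp add: sol_axes_def)
qed

lemma card_Q_sat:
  assumes "m = 2"
  shows "card (Q_sat m s t) = 2"
proof -
  have P: "presents 0 (Q_sat m s t) (sat_quadric sat_axes)" using presents_sat assms by simp
  have "Q_sat m s t \<subseteq> symmetry_axis (sat_quadric sat_axes)"
    unfolding presents_0_axis[OF P] by (rule hull_subset)
  then have "Q_sat m s t = vertices (sat_quadric sat_axes)" using presents_axis_Int[OF P] by blast
  moreover have "e \<noteq> 1" using e_eq_1_imp_m assms by auto
  ultimately show ?thesis using card_vertices(2)[of sat_axes] by (simp add: sat_axes_def)
qed

text \<open>The intersection points are vertices, and in the span of u and
  \<open>U\<^sup>\<bottom>\<close> the vectors orthogonal to the axis form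
  \<open>U\<^sup>\<bottom>\<close>.\<close>

lemma tangent_space_Q_sol:
  assumes "p \<in> Q_sol m s t \<inter> (+) v ` U"
  shows "tangent_space (Q_sol m s t) p = U\<^sup>\<bottom>" "perpendicular ((+) p ` tangent_space (Q_sol m s t) p) ((+) v ` U)"
proof -
  let ?F = "sol_quadric sol_axes"
  note P = presents_focal_form[OF presents_sol]
  have dir: "direction_space (affine hull Q_sol m s t) = span (insert u (U\<^sup>\<bottom>))"
    unfolding affine_hull_Q_sol by (rule direction_space_translation) simp
  have "p \<in> symmetry_axis ?F"
    using assms Q_sol_Int presents_axis_Int[OF presents_sol] by blast
  then obtain \<xi> where p: "p = origin ?F + \<xi> *\<^sub>R axes ?F 0" by (auto simp: symmetry_axis_def)
  have "origin ?F + \<xi> *\<^sub>R axes ?F 0 \<in> focal_form (direction_space (affine hull Q_sol m s t)) ?F"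
    using assms P(5) p by simp
  from tangent_space_focal_set_vertex[OF P(1,3,4,6) this]
  have "tangent_space (Q_sol m s t) p = {z \<in> span (insert u (U\<^sup>\<bottom>)). z \<bullet> axes ?F 0 = 0}"
    unfolding p dir using P(5) by (simp add: dir)
  also have "\<dots> = U\<^sup>\<bottom>"
  proof (intro set_eqI iffI)
    fix z assume "z \<in> {z \<in> span (insert u (U\<^sup>\<bottom>)). z \<bullet> axes ?F 0 = 0}"
    then obtain c y where y: "y \<in> U\<^sup>\<bottom>" "z = c *\<^sub>R u + y" and "z \<bullet> u = 0"
      using span_insert_U_perp e_pos by (auto simp: sol_quadric sol_axes_def)
    then have "c = 0"
      using orth_U[OF u_in_U y(1)] u_nz by (simp add: inner_add_left inner_commute[of y u])
    then show "z \<in> U\<^sup>\<bottom>" using y by simp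
  next
    fix z assume z: "z \<in> U\<^sup>\<bottom>"
    then show "z \<in> {z \<in> span (insert u (U\<^sup>\<bottom>)). z \<bullet> axes ?F 0 = 0}"
      using orth_U[OF u_in_U z] by (simp add: sol_quadric sol_axes_def span_base inner_commute)
  qed
  finally show T: "tangent_space (Q_sol m s t) p = U\<^sup>\<bottom>" .
  have "p - v \<in> U" using assms by (simp add: mem_translation_iff)
  then show "perpendicular ((+) p ` tangent_space (Q_sol m s t) p) ((+) v ` U)"
    unfolding T
  proof (intro perpendicular_translations[of _ _ p] subspace_U subspace_orthogonal_comp)
    show "x \<bullet> y = 0" if "x \<in> U\<^sup>\<bottom>" "y \<in> U" for x y
      using orth_U[OF that(2,1)] by (simp add: inner_commute)
  qed (simp_all add: subspace_0[OF subspace_orthogonal_comp])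
qed

lemma w'_basis: "orthonormal_basis {1..m - 2} w' V"
  unfolding orthonormal_basis_def
proof (intro conjI ballI)
  fix i j assume "i \<in> {1..m - 2}" "j \<in> {1..m - 2}"
  then show "w' i \<bullet> w' j = (if i = j then 1 else 0)" using orthonormal_basisD(1)[OF w', of i j] by auto
qed (simp add: V_def)

lemma affine_hull_satellites: "affine hull (s ` {1..m}) = (+) v ` U"
proof -
  have "affine hull (s ` {1..m}) = (+) (s 1) ` U"
    using general_position_imp(2)[OF general_position m1] by (simp add: U_def)
  also have "\<dots> = (+) v ` U"
    using s_v_in_U[of 1] m1 by (intro translation_subspace_eq subspace_U) simp
  finally show ?thesis .
qed

lemma sol_poly_statement:
  "sol_poly b = (if e \<noteq> 1 then sgn (e\<^sup>2 - 1) * (sqrt \<bar>e\<^sup>2 - 1\<bar> * (b + \<mu>))\<^sup>2 - \<rho> else 2 * \<kappa> * (b - lam1))"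
proof (cases "e = 1")
  case True
  then have "2 * \<kappa> * lam1 = - C" using parabolic_nondegenerate by (simp add: lam1_def)
  then show ?thesis using True parabolic_polys(1)[OF True] by (simp add: right_diff_distrib)
next
  case False
  then show ?thesis using sgn_sqrt[of "e\<^sup>2 - 1" 1 "b + \<mu>"] by (simp add: sol_poly_central)
qed

lemma sat_poly_statement:
  "sat_poly b = (if e \<noteq> 1 then - (sgn (e\<^sup>2 - 1) * (e * sqrt \<bar>e\<^sup>2 - 1\<bar> * (b + \<mu>))\<^sup>2) + \<rho> else - (2 * \<kappa> * (b - lam2)))"
proof (cases "e = 1")
  case True
  then have "2 * \<kappa> * lam2 = - C - \<kappa>\<^sup>2"
    using parabolic_nondegenerate by (simp add: lam1_def lam2_def right_diff_distrib power2_eq_square)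
  then show ?thesis using True parabolic_polys(2)[OF True] by (simp add: right_diff_distrib)
next
  case False
  then show ?thesis using sgn_sqrt[of "e\<^sup>2 - 1" e "b + \<mu>"] by (simp add: sat_poly_central algebra_simps)
qed

end

theorem theorem4p1:
  fixes s w w' :: "nat \<Rightarrow> real ^ 'n"
    and t \<gamma> :: "nat \<Rightarrow> real"
    and m k :: nat
    and u v :: "real ^ 'n"
    and \<alpha> \<beta> e \<mu> \<rho> lam1 lam2 :: real
    and g h :: "(nat \<Rightarrow> real) \<Rightarrow> real"
    and U Qsol Qsat Asol Asat :: "(real ^ 'n) set"
    and Sol Sat :: "(real ^ 'n) focal_quadric set"
  assumes m: "1 \<le> m" "m \<le> CARD('n) + 1"
    and general_position: "aff_dim (s ` {1..m}) = int m - 1"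
    and t_not_all_equal: "\<exists>i\<in>{1..m}. \<exists>j\<in>{1..m}. t i \<noteq> t j"
    and two_solutions: "\<exists>p\<in>solution_set m s t. \<exists>q\<in>solution_set m s t. p \<noteq> q"
    and nondegenerate: "m > 2 \<or> \<bar>t 1 - t 2\<bar> \<noteq> norm (s 1 - s 2)"
    and k: "k = CARD('n) + 1 - m"
    and U: "U = span {s i - s 1 | i. i \<in> {2..m}}"
    and w: "orthonormal_basis {1..k} w (U\<^sup>\<bottom>)"
    and \<gamma>: "\<gamma> = (\<lambda>j. s 1 \<bullet> w j)"
    and v: "(v, \<beta>) = (THE (v, \<beta>).
        (\<forall>i\<in>{1..m}. 2 * (s i \<bullet> v) - \<beta> = (norm (s i))\<^sup>2 - (t i)\<^sup>2) \<and> (\<forall>j\<in>{1..k}. v \<bullet> w j = \<gamma> j))"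
    and u: "(u, \<alpha>) = (THE (u, \<alpha>).
        (\<forall>i\<in>{1..m}. s i \<bullet> u - \<alpha> = t i) \<and> (\<forall>j\<in>{1..k}. u \<bullet> w j = 0))"
    and e: "e = norm u"
    and w': "orthonormal_basis {0..m - 2} (\<lambda>i. if i = 0 then u /\<^sub>R e else w' i) U"
    and \<mu>: "\<mu> = (u \<bullet> v - \<alpha>) / (e\<^sup>2 - 1)"
    and \<rho>: "\<rho> = (u \<bullet> v - \<alpha>)\<^sup>2 / (e\<^sup>2 - 1) - (norm v)\<^sup>2 + \<beta>"
    and lam1: "lam1 = (\<beta> - (norm v)\<^sup>2) / (2 * (u \<bullet> v - \<alpha>))"
    and lam2: "lam2 = lam1 - (u \<bullet> v - \<alpha>) / 2"
    and g: "g = (\<lambda>y. if e \<noteq> 1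
        then (\<Sum>j=1..k. (y j)\<^sup>2) + sgn (e\<^sup>2 - 1) * (sqrt \<bar>e\<^sup>2 - 1\<bar> * (y 0 + \<mu>))\<^sup>2 - \<rho>
        else (\<Sum>j=1..k. (y j)\<^sup>2) + 2 * (u \<bullet> v - \<alpha>) * (y 0 - lam1))"
    and h: "h = (\<lambda>z. if e \<noteq> 1
        then (\<Sum>i=1..m-2. (z i)\<^sup>2) - sgn (e\<^sup>2 - 1) * (e * sqrt \<bar>e\<^sup>2 - 1\<bar> * (z 0 + \<mu>))\<^sup>2 + \<rho>
        else (\<Sum>i=1..m-2. (z i)\<^sup>2) - 2 * (u \<bullet> v - \<alpha>) * (z 0 - lam2))"
    and Qsol: "Qsol = Q_sol m s t"
    and Qsat: "Qsat = Q_sat m s t"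
    and Asol: "Asol = affine hull Qsol"
    and Asat: "Asat = affine hull Qsat"
    \<comment> \<open>The presentations of the two quadrics; a two-point quadric is presented with the semiaxes fixed
      by convention.\<close>
    and Sol: "Sol = {F. presents k Qsol F \<and> (k = 0 \<longrightarrow> (\<exists>q.
        F = (if e > 1 then Spheroid else Hyperboloid)
              (v - \<mu> *\<^sub>R u) q (e * sqrt (\<rho> / (e\<^sup>2 - 1))) (sqrt \<bar>\<rho>\<bar>)))}"
    and Sat: "Sat = {G. presents (m - 2) Qsat G \<and> (m = 2 \<longrightarrow> (\<exists>q.
        G = (if e > 1 then Hyperboloid else Spheroid)
              (v - \<mu> *\<^sub>R u) q (sqrt (\<rho> / (e\<^sup>2 - 1))) (sqrt \<bar>\<rho>\<bar>)))}"
  shows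
    \<comment> \<open>(a)\<close>
    "Qsol = {v + y 0 *\<^sub>R u + (\<Sum>j=1..k. y j *\<^sub>R w j) | y. g y = 0} \<and>
     Qsat = {v + z 0 *\<^sub>R u + (\<Sum>i=1..m-2. z i *\<^sub>R w' i) | z. h z = 0} \<and>
     \<comment> \<open>(b)\<close>
     Asol = (+) v ` span (insert u (w ` {1..k})) \<and>
     Asol = {v + c *\<^sub>R u + x | c x. x \<in> U\<^sup>\<bottom>} \<and>
     Asat = (+) v ` span (insert u (w' ` {1..m-2})) \<and>
     Asat = (+) v ` U \<and>
     Asat = affine hull (s ` {1..m}) \<and>
     aff_dim Asol = int k + 1 \<and>
     aff_dim Asat = int m - 1 \<and>
     perpendicular Asol Asat \<and>
     Asol \<inter> Asat = {v + c *\<^sub>R u | c. True} \<and>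
     \<comment> \<open>(c)\<close>
     (\<exists>F. F \<in> Sol) \<and>
     (\<exists>G. G \<in> Sat) \<and>
     (k = 0 \<longrightarrow> card Qsol = 2) \<and>
     (m = 2 \<longrightarrow> card Qsat = 2) \<and>
     (\<forall>F\<in>Sol. symmetry_axis F = {v + c *\<^sub>R u | c. True}) \<and>
     (\<forall>G\<in>Sat. symmetry_axis G = {v + c *\<^sub>R u | c. True}) \<and>
     \<comment> \<open>(d)\<close>
     (\<forall>F\<in>Sol. \<forall>G\<in>Sat. foci G = vertices F \<and> foci F = vertices G \<and>
        eccentricity F * eccentricity G = 1) \<and>
     (\<forall>G\<in>Sat. \<forall>x\<in>foci G. \<exists>b. (b, x) \<in> solution_set m s t) \<and>
     \<comment> \<open>(e)\<close>
     (\<forall>F\<in>Sol. Qsol \<inter> Asat = vertices F) \<and>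
     (\<forall>p\<in>Qsol \<inter> Asat. tangent_space Qsol p = U\<^sup>\<bottom> \<and>
        perpendicular ((+) p ` tangent_space Qsol p) Asat)"
proof -
  have m1: "1 \<le> m" by (rule m(1))
  have uniq_v: "\<exists>!(v, \<beta>). (\<forall>i\<in>{1..m}. 2 * (s i \<bullet> v) - \<beta> = (norm (s i))\<^sup>2 - (t i)\<^sup>2) \<and>
      (\<forall>j\<in>{1..k}. v \<bullet> w j = \<gamma> j)"
    by (rule ex1_linear_system[OF general_position m1 _ U w]) simp
  \<comment> \<open>The factor \<open>1 *\<close> instantiates r in the general system and is
    removed again by \<open>mult_1\<close>.\<close>
  have uniq_u: "\<exists>!(u, \<alpha>). (\<forall>i\<in>{1..m}. 1 * (s i \<bullet> u) - \<alpha> = t i) \<and> (\<forall>j\<in>{1..k}. u \<bullet> w j = 0)"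
    by (rule ex1_linear_system[OF general_position m1 _ U w]) simp
  have V: "(\<forall>i\<in>{1..m}. 2 * (s i \<bullet> v) - \<beta> = (norm (s i))\<^sup>2 - (t i)\<^sup>2) \<and> (\<forall>j\<in>{1..k}. v \<bullet> w j = \<gamma> j)"
    by (rule pair_eq_The[OF v uniq_v])
  have U': "(\<forall>i\<in>{1..m}. s i \<bullet> u - \<alpha> = t i) \<and> (\<forall>j\<in>{1..k}. u \<bullet> w j = 0)"
    by (rule pair_eq_The[OF u uniq_u[unfolded mult_1]])
  interpret S: satellite_system m k s w w' t U u v \<alpha> \<beta> e
    by unfold_locales
      (use m1 general_position t_not_all_equal two_solutions nondegenerate U w V U' e w' \<gamma> in auto)
  have \<kappa>: "u \<bullet> v - \<alpha> = S.\<kappa>" by (simp add: S.\<kappa>_def)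
  have C: "(norm v)\<^sup>2 - \<beta> = S.C" by (simp add: S.C_def power2_norm_eq_inner)
  have \<mu>': "\<mu> = S.\<mu>" by (simp add: S.\<mu>_def \<mu> \<kappa>)
  have \<rho>': "\<rho> = S.\<rho>" by (simp add: S.\<rho>_def \<rho> \<kappa> C[symmetric])
  have lam1': "lam1 = S.lam1" unfolding S.lam1_def lam1 \<kappa> C[symmetric] by simp
  have lam2': "lam2 = S.lam2" unfolding S.lam2_def lam2 \<kappa> lam1' ..
  have g': "g y = (\<Sum>j=1..k. (y j)\<^sup>2) + S.sol_poly (y 0)" for y
    unfolding g S.sol_poly_statement \<kappa> \<mu>' \<rho>' lam1' by simp
  have h': "h z = (\<Sum>i=1..m-2. (z i)\<^sup>2) + S.sat_poly (z 0)" for z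
    unfolding h S.sat_poly_statement \<kappa> \<mu>' \<rho>' lam2' by simp
  have Sol': "Sol = S.Sol" unfolding Sol S.Sol_def Qsol \<mu>' \<rho>' ..
  have Sat': "Sat = S.Sat" unfolding Sat S.Sat_def Qsat \<mu>' \<rho>' ..
  have Asol': "Asol = (+) v ` span (insert u (U\<^sup>\<bottom>))" unfolding Asol Qsol by (rule S.affine_hull_Q_sol)
  have Asat': "Asat = (+) v ` U" unfolding Asat Qsat by (rule S.affine_hull_Q_sat)
  have Qsol_Int: "Qsol \<inter> Asat = vertices (S.sol_quadric S.sol_axes)"
    unfolding Qsol Asat' by (rule S.Q_sol_Int)
  show ?thesis
  proof (intro conjI)
    show "Qsol = {v + y 0 *\<^sub>R u + (\<Sum>j=1..k. y j *\<^sub>R w j) | y. g y = 0}"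
      unfolding Qsol S.Q_sol_eq g' by (rule orthonormal_coordinates[OF w])
    show "Qsat = {v + z 0 *\<^sub>R u + (\<Sum>i=1..m-2. z i *\<^sub>R w' i) | z. h z = 0}"
      unfolding Qsat S.Q_sat_eq h' by (rule orthonormal_coordinates[OF S.w'_basis])
    show "Asol = (+) v ` span (insert u (w ` {1..k}))" unfolding Asol' S.span_insert_w ..
    show "Asol = {v + c *\<^sub>R u + x | c x. x \<in> U\<^sup>\<bottom>}" unfolding Asol' by (rule S.translation_span_insert)
    show "Asat = (+) v ` span (insert u (w' ` {1..m-2}))" unfolding Asat' S.U_eq_insert[symmetric] ..
    show "Asat = (+) v ` U" by (rule Asat')
    show "Asat = affine hull (s ` {1..m})" unfolding Asat' S.affine_hull_satellites ..
    show "aff_dim Asol = int k + 1"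
      using dim_orthonormal_basis[OF S.sol_axes_basis] by (simp add: Asol' aff_dim_translation_eq aff_dim_subspace)
    show "aff_dim Asat = int m - 1"
      unfolding Asat' S.affine_hull_satellites[symmetric] unfolding aff_dim_affine_hull by (rule general_position)
    show "perpendicular Asol Asat" unfolding Asol' Asat' by (rule S.hulls_perpendicular)
    show "Asol \<inter> Asat = {v + c *\<^sub>R u | c. True}" unfolding Asol' Asat' by (rule S.hulls_Int)
    show "\<exists>F. F \<in> Sol" "\<exists>G. G \<in> Sat"
      unfolding Sol' Sat' using S.sol_quadric_in_Sol S.sat_quadric_in_Sat by blast+
    show "k = 0 \<longrightarrow> card Qsol = 2" "m = 2 \<longrightarrow> card Qsat = 2"
      unfolding Qsol Qsat using S.card_Q_sol S.card_Q_sat by blast+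
    show "\<forall>F\<in>Sol. symmetry_axis F = {v + c *\<^sub>R u | c. True}" "\<forall>G\<in>Sat. symmetry_axis G = {v + c *\<^sub>R u | c. True}"
      unfolding Sol' Sat' using S.Sol_invariants(2) S.Sat_invariants(2) S.symmetry_axes by blast+
    show "\<forall>F\<in>Sol. \<forall>G\<in>Sat. foci G = vertices F \<and> foci F = vertices G \<and> eccentricity F * eccentricity G = 1"
      unfolding Sol' Sat' using S.Sol_invariants S.Sat_invariants S.sol_sat_foci_vertices S.e_pos by simp
    show "\<forall>G\<in>Sat. \<forall>x\<in>foci G. \<exists>b. (b, x) \<in> solution_set m s t"
    proof (intro ballI)
      fix G x assume "G \<in> Sat" "x \<in> foci G"
      then have "x \<in> Qsol"
        using Qsol_Int S.Sat_invariants(4) S.sol_sat_foci_vertices(1) unfolding Sat' by blast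
      then show "\<exists>b. (b, x) \<in> solution_set m s t" by (simp add: Qsol Q_sol_def)
    qed
    show "\<forall>F\<in>Sol. Qsol \<inter> Asat = vertices F"
      unfolding Qsol_Int Sol' using S.Sol_invariants(3) by simp
    show "\<forall>p\<in>Qsol \<inter> Asat. tangent_space Qsol p = U\<^sup>\<bottom> \<and> perpendicular ((+) p ` tangent_space Qsol p) Asat"
      unfolding Qsol Asat' using S.tangent_space_Q_sol by blast
  qed
qed

end
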